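(* For all $u,v\in S_{\mathbb{Z}_+}$, \[\mathrm{FS}(u,v)=\max_{i\le 1+\max(\mathrm{FS}(u),\mathrm{FS}(v))}\bigl(\Lambda_i(u)+\Lambda_i(v)+i-1\bigr),\] the maximum being over integers $i$.
   Context: $S_{\mathbb{Z}_+}$ is the group of permutations of the positive integers fixing all but finitely many (viewed inside bijections of $\mathbb{Z}$ fixing all integers $\le 0$), and $S_n\subseteq S_{\mathbb{Z}_+}$ those fixing all integers $>n$. Schubert structure constants $c_{u,v}^w$ are defined by $\mathfrak{S}_u\mathfrak{S}_v=\sum_w c_{u,v}^w\mathfrak{S}_w$ in terms of Schubert polynomials. For $w\in S_{\mathbb{Z}_+}$, $\mathrm{FS}(w)=\min\{n\ge 1: w\in S_n\}$, and $\mathrm{FS}(u,v)=\max\{\mathrm{FS}(w): c_{u,v}^w\neq 0\}$. For $w$ and $i\in\mathbb{Z}$, $\Lambda_i(w)=|\{j\ge i : \exists j'<j \text{ with } w(j')>w(j)\}|$ (the number of nonzero entries, with index at least $i$, of the dual Lehmer code $\mathrm{dualcode}(w)_j=|\{j'<j: w(j')>w(j)\}|$). *)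

theory Defs
  imports Complex_Main "HOL-Library.Poly_Mapping" "HOL-Combinatorics.Transposition"
    "HOL-Combinatorics.Permutations"
begin

definition S_pos :: "(int \<Rightarrow> int) set" where
  "S_pos = {w. w permutes {1..} \<and> finite {j. w j \<noteq> j}}"

definition S_fin :: "nat \<Rightarrow> (int \<Rightarrow> int) set" where
  "S_fin n = {w \<in> S_pos. \<forall>j > int n. w j = j}"

text \<open>Integer polynomials in variables indexed by the integers; a monomial is its finitely
  supported exponent vector. Only variables with positive index occur in Schubert polynomials.\<close>

type_synonym int_mpoly = "(int \<Rightarrow>\<^sub>0 nat) \<Rightarrow>\<^sub>0 int"

definition X :: "int \<Rightarrow> int_mpoly" where
  "X i = Poly_Mapping.single (Poly_Mapping.single i 1) 1"

text \<open>The coefficient of the result at a monomial \<open>m\<close> is that of \<open>f\<close> at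
  \<open>m \<circ> transpose i (i + 1)\<close>, that is, the variables \<open>X i\<close> and \<open>X (i + 1)\<close> are interchanged.\<close>

definition swap_vars :: "int \<Rightarrow> int_mpoly \<Rightarrow> int_mpoly" where
  "swap_vars i f = Poly_Mapping.map_key (Poly_Mapping.map_key (transpose i (i + 1))) f"

text \<open>\<open>(f - s\<^sub>i f) / (X i - X (i + 1))\<close>; the division is exact and the quotient is unique.\<close>

definition divdiff :: "int \<Rightarrow> int_mpoly \<Rightarrow> int_mpoly" where
  "divdiff i f = (THE g. (X i - X (i + 1)) * g = f - swap_vars i f)"

definition longest :: "nat \<Rightarrow> int \<Rightarrow> int" where
  "longest n j = (if 1 \<le> j \<and> j \<le> int n then int n + 1 - j else j)"

text \<open>The Lascoux--Schuetzenberger recursion. That the polynomial does not depend on \<open>n\<close> or on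
  the chain of descents is a theorem, so it is introduced as a relation.\<close>

inductive is_schubert :: "(int \<Rightarrow> int) \<Rightarrow> int_mpoly \<Rightarrow> bool" where
  longest: "is_schubert (longest n) (\<Prod>i = 1..n. X (int i) ^ (n - i))"
| descent: "is_schubert w p \<Longrightarrow> i \<ge> 1 \<Longrightarrow> w i > w (i + 1)
    \<Longrightarrow> is_schubert (w \<circ> transpose i (i + 1)) (divdiff i p)"

definition schubert :: "(int \<Rightarrow> int) \<Rightarrow> int_mpoly" where
  "schubert w = (THE p. is_schubert w p)"

definition schubert_const :: "(int \<Rightarrow> int) \<Rightarrow> (int \<Rightarrow> int) \<Rightarrow> (int \<Rightarrow> int) \<Rightarrow> int" where
  "schubert_const u v = (THE c. finite {w. c w \<noteq> 0} \<and> {w. c w \<noteq> 0} \<subseteq> S_pos \<and>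
     schubert u * schubert v = (\<Sum>w | c w \<noteq> 0. of_int (c w) * schubert w))"

definition FS :: "(int \<Rightarrow> int) \<Rightarrow> nat" where
  "FS w = (LEAST n. n \<ge> 1 \<and> w \<in> S_fin n)"

definition FS_prod :: "(int \<Rightarrow> int) \<Rightarrow> (int \<Rightarrow> int) \<Rightarrow> nat" where
  "FS_prod u v = Max {FS w | w. w \<in> S_pos \<and> schubert_const u v w \<noteq> 0}"

definition Lam :: "int \<Rightarrow> (int \<Rightarrow> int) \<Rightarrow> nat" where
  "Lam i w = card {j. j \<ge> i \<and> (\<exists>j' < j. w j' > w j)}"

text \<open>\<open>Max\<close> is meaningless on infinite sets, so an attained maximum over all integers below a
  bound is expressed as a relation.\<close>

definition is_max :: "'a::linorder \<Rightarrow> 'a set \<Rightarrow> bool" where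
  "is_max m A \<longleftrightarrow> m \<in> A \<and> (\<forall>x\<in>A. x \<le> m)"

end

theory Submission
  imports Defs
begin

text \<open>
  The Schubert polynomials of \<open>S\<^sub>n\<close> and the monomials dividing the staircase monomial
  \<open>x\<^sub>1\<^bsup>n-1\<^esup> x\<^sub>2\<^bsup>n-2\<^esup> \<cdots>\<close> span the same
  lattice, because divided differences preserve the staircase condition. Hence the largest
  \<open>FS w\<close> occurring in a product is read off from the degrees of the product in the single
  variables, which are additive. The degree of a Schubert polynomial in \<open>x\<^sub>k\<close> is the number
  of positions \<open>j > k\<close> such that \<open>w i > w j\<close> for some \<open>k \<le> i < j\<close>: if \<open>k\<close> is an ascent, then
  \<open>x\<^sub>k\<close> and \<open>x\<^sub>k\<^sub>+\<^sub>1\<close> play symmetric roles; if \<open>k\<close> is a descent, compare degrees in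
  \<open>f - s\<^sub>k f = (x\<^sub>k - x\<^sub>k\<^sub>+\<^sub>1) \<partial>\<^sub>k f\<close>. This number is at most \<open>\<Lambda>\<^sub>k\<^sub>+\<^sub>1(w)\<close>, with
  equality when \<open>w k\<close> is a left-to-right maximum, and the maximum in the theorem is attained
  where both permutations have one.
\<close>

subsection \<open>Weighted degrees\<close>

text \<open>\<open>schubert\<close> and \<open>schubert_const\<close> are definite descriptions.
  They say nothing until the recursion is known not to depend on the chain of descents or on n,
  which rests on the braid relations, and until expansions in Schubert polynomials are known to
  exist and to be unique. Existence comes from functionals that take the constant term after
  iterated divided differences. The link with FS is an equivalence for each n \<ge> 1: every w in
  the support of the product lies in S_n exactly if the product has degree at most max(n - j, 0) in
  each x_j with j \<ge> 1, and does not involve x_j with j < 1. Both sides of the formula are then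
  compared through their upper bounds n, which suits an index set without lower end. The limit 1 +
  max(FS(u), FS(v)) is natural: from there on both counts vanish and only i - 1 grows. If position i
  is not a left-to-right maximum of u or of v, passing from i to i + 1 lowers some count by 1, so
  the value does not increase; this confines the maximum to the positions named above.\<close>

definition wdeg :: "('a \<Rightarrow> nat) \<Rightarrow> ('a \<Rightarrow>\<^sub>0 int) \<Rightarrow> nat" where
  "wdeg \<phi> f = Max (insert 0 (\<phi> ` Poly_Mapping.keys f))"

lemma wdeg_le_iff: "wdeg \<phi> f \<le> d \<longleftrightarrow> (\<forall>m\<in>Poly_Mapping.keys f. \<phi> m \<le> d)"
  by (auto simp: wdeg_def)

lemma le_wdeg: "m \<in> Poly_Mapping.keys f \<Longrightarrow> \<phi> m \<le> wdeg \<phi> f"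
  using wdeg_le_iff[of \<phi> f "wdeg \<phi> f"] by simp

lemma wdeg_zero [simp]: "wdeg \<phi> 0 = 0"
  by (simp add: wdeg_def)

lemma wdeg_attained:
  assumes "f \<noteq> 0"
  shows "\<exists>m\<in>Poly_Mapping.keys f. \<phi> m = wdeg \<phi> f"
proof (cases "wdeg \<phi> f = 0")
  case True
  obtain m where m: "m \<in> Poly_Mapping.keys f"
    using assms keys_eq_empty by fastforce
  then show ?thesis
    using le_wdeg[OF m, of \<phi>] True by auto
next
  case False
  have "wdeg \<phi> f \<in> insert 0 (\<phi> ` Poly_Mapping.keys f)"
    unfolding wdeg_def by (rule Max_in) auto
  then show ?thesis
    using False by (auto simp: image_iff)
qed

lemma wdeg_diff_le: "wdeg \<phi> (f - g) \<le> max (wdeg \<phi> f) (wdeg \<phi> g)"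
  unfolding wdeg_le_iff
proof
  fix m assume "m \<in> Poly_Mapping.keys (f - g)"
  then have "m \<in> Poly_Mapping.keys f \<or> m \<in> Poly_Mapping.keys g"
    using keys_diff[of f g] by auto
  then show "\<phi> m \<le> max (wdeg \<phi> f) (wdeg \<phi> g)"
    using le_wdeg[of m f \<phi>] le_wdeg[of m g \<phi>] by (auto simp: le_max_iff_disj)
qed

lemma wdeg_add_le: "wdeg \<phi> (f + g) \<le> max (wdeg \<phi> f) (wdeg \<phi> g)"
  unfolding wdeg_le_iff
proof
  fix m assume "m \<in> Poly_Mapping.keys (f + g)"
  then have "m \<in> Poly_Mapping.keys f \<or> m \<in> Poly_Mapping.keys g"
    using keys_add[of f g] by auto
  then show "\<phi> m \<le> max (wdeg \<phi> f) (wdeg \<phi> g)"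
    using le_wdeg[of m f \<phi>] le_wdeg[of m g \<phi>] by (auto simp: le_max_iff_disj)
qed

text \<open>Since f is the difference of f + g and g, the smaller degree of g forces f + g to carry
  the degree of f.\<close>

lemma wdeg_add_eq:
  assumes "wdeg \<phi> g < wdeg \<phi> f"
  shows "wdeg \<phi> (f + g) = wdeg \<phi> f"
  using wdeg_add_le[of \<phi> f g] wdeg_diff_le[of \<phi> "f + g" g] assms by simp

lemma wdeg_sum_le:
  assumes "\<And>x. x \<in> A \<Longrightarrow> wdeg \<phi> (f x) \<le> d"
  shows "wdeg \<phi> (sum f A) \<le> d"
  using assms
proof (induction A rule: infinite_finite_induct)
  case (insert x A)
  then show ?case
    using order_trans[OF wdeg_add_le[of \<phi> "f x" "sum f A"], of d] by simp
qed auto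

definition wpart :: "('a \<Rightarrow> nat) \<Rightarrow> nat \<Rightarrow> ('a \<Rightarrow>\<^sub>0 int) \<Rightarrow> ('a \<Rightarrow>\<^sub>0 int)" where
  "wpart \<phi> d f = Poly_Mapping.mapp (\<lambda>m c. c when \<phi> m = d) f"

lemma lookup_wpart:
  "Poly_Mapping.lookup (wpart \<phi> d f) m = (Poly_Mapping.lookup f m when \<phi> m = d)"
  by (simp add: wpart_def lookup_mapp in_keys_iff when_def)

lemma keys_wpart: "Poly_Mapping.keys (wpart \<phi> d f) = {m \<in> Poly_Mapping.keys f. \<phi> m = d}"
  by (auto simp: in_keys_iff lookup_wpart)

lemma keys_diff_wpart: "Poly_Mapping.keys (f - wpart \<phi> d f) = {m \<in> Poly_Mapping.keys f. \<phi> m \<noteq> d}"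
  by (auto simp: in_keys_iff lookup_minus lookup_wpart when_def split: if_splits)

lemma wpart_add: "wpart \<phi> d (f + g) = wpart \<phi> d f + wpart \<phi> d g"
  by (rule poly_mapping_eqI) (simp add: lookup_wpart lookup_add when_def)

lemma wpart_diff: "wpart \<phi> d (f - g) = wpart \<phi> d f - wpart \<phi> d g"
  by (rule poly_mapping_eqI) (simp add: lookup_wpart lookup_minus when_def)

text \<open>The product of the two parts of top weight is nonzero, because the order on the
  exponents makes the ring a domain. All other contributions have smaller weight, so none can cancel
  its monomials. The factors must be nonzero because the zero polynomial has degree 0 by
  convention.\<close>

lemma wdeg_mult:
  fixes f g :: "('a::{ordered_cancel_comm_monoid_add, linorder}) \<Rightarrow>\<^sub>0 int"
  assumes add: "\<And>a b. \<phi> (a + b) = \<phi> a + \<phi> b" and "f \<noteq> 0" "g \<noteq> 0"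
  shows "wdeg \<phi> (f * g) = wdeg \<phi> f + wdeg \<phi> g"
proof -
  let ?d = "wdeg \<phi> f" and ?e = "wdeg \<phi> g"
  define t l where "t = wpart \<phi> ?d f" and "l = f - t"
  define t' l' where "t' = wpart \<phi> ?e g" and "l' = g - t'"
  have f: "f = t + l" and g: "g = t' + l'"
    by (simp_all add: l_def l'_def)
  have t: "\<phi> m = ?d" if "m \<in> Poly_Mapping.keys t" for m
    using that by (simp add: t_def keys_wpart)
  have t': "\<phi> m = ?e" if "m \<in> Poly_Mapping.keys t'" for m
    using that by (simp add: t'_def keys_wpart)
  have l: "\<phi> m < ?d" if "m \<in> Poly_Mapping.keys l" for m
    using that le_wdeg[of m f \<phi>] by (auto simp: t_def l_def keys_diff_wpart)
  have l': "\<phi> m < ?e" if "m \<in> Poly_Mapping.keys l'" for m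
    using that le_wdeg[of m g \<phi>] by (auto simp: t'_def l'_def keys_diff_wpart)
  have "t \<noteq> 0" "t' \<noteq> 0"
    using wdeg_attained[OF \<open>f \<noteq> 0\<close>, of \<phi>] wdeg_attained[OF \<open>g \<noteq> 0\<close>, of \<phi>]
    unfolding t_def t'_def keys_eq_empty[symmetric] by (auto simp: keys_wpart)
  then have "t * t' \<noteq> 0"
    by simp
  then obtain m where m: "m \<in> Poly_Mapping.keys (t * t')"
    using keys_eq_empty by blast
  have mdeg: "\<phi> m = ?d + ?e"
  proof -
    obtain a b where "m = a + b" "a \<in> Poly_Mapping.keys t" "b \<in> Poly_Mapping.keys t'"
      using m keys_mult[of t t'] by blast
    then show ?thesis
      using t[of a] t'[of b] by (simp add: add)
  qed
  have "m \<notin> Poly_Mapping.keys (t * l')"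
  proof
    assume "m \<in> Poly_Mapping.keys (t * l')"
    then obtain a b where "m = a + b" "a \<in> Poly_Mapping.keys t" "b \<in> Poly_Mapping.keys l'"
      using keys_mult[of t l'] by blast
    then show False
      using t[of a] l'[of b] mdeg by (simp add: add)
  qed
  moreover have "m \<notin> Poly_Mapping.keys (l * g)"
  proof
    assume "m \<in> Poly_Mapping.keys (l * g)"
    then obtain a b where "m = a + b" "a \<in> Poly_Mapping.keys l" "b \<in> Poly_Mapping.keys g"
      using keys_mult[of l g] by blast
    then show False
      using l[of a] le_wdeg[of b g \<phi>] mdeg by (simp add: add)
  qed
  moreover have "f * g = t * t' + t * l' + l * g"
    by (simp add: f g algebra_simps)
  ultimately have "m \<in> Poly_Mapping.keys (f * g)"
    using m by (simp add: in_keys_iff lookup_add)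
  then have "?d + ?e \<le> wdeg \<phi> (f * g)"
    using le_wdeg mdeg by metis
  moreover have "wdeg \<phi> (f * g) \<le> ?d + ?e"
    unfolding wdeg_le_iff
  proof
    fix m assume "m \<in> Poly_Mapping.keys (f * g)"
    then obtain a b where "m = a + b" "a \<in> Poly_Mapping.keys f" "b \<in> Poly_Mapping.keys g"
      using keys_mult[of f g] by blast
    then show "\<phi> m \<le> ?d + ?e"
      by (simp add: add add_mono le_wdeg)
  qed
  ultimately show ?thesis by simp
qed

lemma wdeg_of_int_mult_le:
  fixes f :: "('a::{ordered_cancel_comm_monoid_add, linorder}) \<Rightarrow>\<^sub>0 int"
  assumes "\<And>a b. \<phi> (a + b) = \<phi> a + \<phi> b"
  shows "wdeg \<phi> (of_int c * f) \<le> wdeg \<phi> f"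
proof -
  have "\<phi> 0 = 0"
    using assms[of 0 0] by simp
  then have "wdeg \<phi> (of_int c :: 'a \<Rightarrow>\<^sub>0 int) = 0"
    by (simp add: wdeg_def flip: single_of_int)
  then show ?thesis
    using wdeg_mult[of \<phi> "of_int c" f, OF assms] by (cases "of_int c * f = 0") auto
qed

abbreviation vdeg :: "int \<Rightarrow> int_mpoly \<Rightarrow> nat" where
  "vdeg j \<equiv> wdeg (\<lambda>m. Poly_Mapping.lookup m j)"

lemma vdeg_mult: "f \<noteq> 0 \<Longrightarrow> g \<noteq> 0 \<Longrightarrow> vdeg j (f * g) = vdeg j f + vdeg j g"
  by (rule wdeg_mult) (auto simp: lookup_add)

lemma vdeg_of_int_mult_le: "vdeg j (of_int c * f) \<le> vdeg j f"
  by (rule wdeg_of_int_mult_le) (auto simp: lookup_add)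

subsection \<open>Divided differences\<close>

abbreviation swap_mon :: "int \<Rightarrow> (int \<Rightarrow>\<^sub>0 nat) \<Rightarrow> (int \<Rightarrow>\<^sub>0 nat)" where
  "swap_mon i \<equiv> Poly_Mapping.map_key (transpose i (i + 1))"

lemma lookup_swap_mon:
  "Poly_Mapping.lookup (swap_mon i m) j = Poly_Mapping.lookup m (transpose i (i + 1) j)"
  by (simp add: map_key.rep_eq)

lemma swap_mon_swap_mon [simp]: "swap_mon i (swap_mon i m) = m"
  by (rule poly_mapping_eqI) (simp add: lookup_swap_mon)

lemma swap_mon_zero [simp]: "swap_mon i 0 = 0"
  by (rule poly_mapping_eqI) (simp add: lookup_swap_mon)

lemma swap_mon_add: "swap_mon i (m + n) = swap_mon i m + swap_mon i n"
  by (rule poly_mapping_eqI) (simp add: lookup_swap_mon lookup_add)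

lemma inj_swap_mon: "inj (swap_mon i)"
  by (metis injI swap_mon_swap_mon)

lemma lookup_swap_vars:
  "Poly_Mapping.lookup (swap_vars i f) m = Poly_Mapping.lookup f (swap_mon i m)"
  by (simp add: swap_vars_def map_key.rep_eq[OF inj_swap_mon])

lemma swap_vars_single: "swap_vars i (Poly_Mapping.single m c) = Poly_Mapping.single (swap_mon i m) c"
  by (rule poly_mapping_eqI) (auto simp: lookup_swap_vars lookup_single when_def)

lemma swap_vars_swap_vars [simp]: "swap_vars i (swap_vars i f) = f"
  by (rule poly_mapping_eqI) (simp add: lookup_swap_vars)

lemma swap_vars_zero [simp]: "swap_vars i 0 = 0"
  by (rule poly_mapping_eqI) (simp add: lookup_swap_vars)

lemma swap_vars_add: "swap_vars i (f + g) = swap_vars i f + swap_vars i g"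
  by (rule poly_mapping_eqI) (simp add: lookup_swap_vars lookup_add)

lemma swap_vars_diff: "swap_vars i (f - g) = swap_vars i f - swap_vars i g"
  by (rule poly_mapping_eqI) (simp add: lookup_swap_vars lookup_minus)

text \<open>Tailored to additive claims: updating at a fresh exponent is the addition of a single
  term.\<close>

lemma mpoly_additive_induct [case_names single add]:
  fixes f :: "'a \<Rightarrow>\<^sub>0 int"
  assumes "\<And>m c. P (Poly_Mapping.single m c)" and "\<And>f g. P f \<Longrightarrow> P g \<Longrightarrow> P (f + g)"
  shows "P f"
proof (induction f rule: update_induct)
  case const
  then show ?case
    using assms(1)[of _ 0] by simp
next
  case (update f a b)
  have "Poly_Mapping.update a b f = f + Poly_Mapping.single a b"
    using update by (intro poly_mapping_eqI)
      (auto simp: lookup_update lookup_add lookup_single when_def in_keys_iff)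
  then show ?case
    using update assms by simp
qed

text \<open>A homogeneous factor of weight e shifts every weight by e. With e = 1 this shows that
  dividing by X i - X (i + 1) preserves homogeneity.\<close>

lemma wpart_mult_homogeneous:
  fixes a g :: "('a::{ordered_cancel_comm_monoid_add, linorder}) \<Rightarrow>\<^sub>0 int"
  assumes add: "\<And>a b. \<phi> (a + b) = \<phi> a + \<phi> b"
    and a: "\<And>m. m \<in> Poly_Mapping.keys a \<Longrightarrow> \<phi> m = e"
  shows "wpart \<phi> (e + d) (a * g) = a * wpart \<phi> d g"
proof (induction g rule: mpoly_additive_induct)
  case (single m c)
  have k: "\<phi> k = e + \<phi> m" if k: "k \<in> Poly_Mapping.keys (a * Poly_Mapping.single m c)" for k
  proof -
    obtain b where "k = b + m" "b \<in> Poly_Mapping.keys a"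
      using k keys_mult[of a "Poly_Mapping.single m c"] by (auto split: if_splits)
    then show ?thesis
      using a[of b] by (simp add: add)
  qed
  show ?case
  proof (cases "\<phi> m = d")
    case True
    have "wpart \<phi> d (Poly_Mapping.single m c) = Poly_Mapping.single m c"
      by (rule poly_mapping_eqI) (auto simp: lookup_wpart lookup_single when_def True)
    moreover have "wpart \<phi> (e + d) (a * Poly_Mapping.single m c) = a * Poly_Mapping.single m c"
      using k True by (intro poly_mapping_eqI) (auto simp: lookup_wpart when_def in_keys_iff)
    ultimately show ?thesis by simp
  next
    case False
    then have "wpart \<phi> d (Poly_Mapping.single m c) = 0"
      by (intro poly_mapping_eqI) (auto simp: lookup_wpart lookup_single when_def)
    moreover have "wpart \<phi> (e + d) (a * Poly_Mapping.single m c) = 0"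
      unfolding keys_eq_empty[symmetric] keys_wpart using False by (auto dest: k)
    ultimately show ?thesis by simp
  qed
qed (simp add: wpart_add distrib_left)

lemma swap_vars_mult: "swap_vars i (f * g) = swap_vars i f * swap_vars i g"
proof (induction f rule: mpoly_additive_induct)
  case (single m c)
  show ?case
    by (induction g rule: mpoly_additive_induct)
       (simp_all add: swap_vars_add distrib_left swap_vars_single mult_single swap_mon_add)
qed (simp add: swap_vars_add distrib_right)

lemma swap_vars_of_int [simp]: "swap_vars i (of_int c) = of_int c"
  by (simp add: swap_vars_single flip: single_of_int)

lemma swap_vars_one [simp]: "swap_vars i 1 = 1"
  using swap_vars_of_int[of i 1] by simp

lemma swap_vars_power: "swap_vars i (f ^ n) = swap_vars i f ^ n"
  by (induction n) (simp_all add: swap_vars_mult)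

lemma swap_vars_X: "swap_vars i (X j) = X (transpose i (i + 1) j)"
proof -
  have "swap_mon i (Poly_Mapping.single j 1) = Poly_Mapping.single (transpose i (i + 1) j) 1"
    by (rule poly_mapping_eqI) (auto simp: lookup_swap_mon lookup_single when_def transpose_def)
  then show ?thesis
    by (simp add: X_def swap_vars_single)
qed

lemma swap_vars_commute:
  assumes "\<And>j. transpose i (i + 1) (transpose k (k + 1) j) = transpose k (k + 1) (transpose i (i + 1) j)"
  shows "swap_vars i (swap_vars k f) = swap_vars k (swap_vars i f)"
proof -
  have "swap_mon k (swap_mon i m) = swap_mon i (swap_mon k m)" for m
    by (rule poly_mapping_eqI) (simp only: lookup_swap_mon assms)
  then show ?thesis
    by (intro poly_mapping_eqI) (simp add: lookup_swap_vars)
qed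

lemma swap_vars_braid:
  "swap_vars i (swap_vars (i + 1) (swap_vars i f)) =
   swap_vars (i + 1) (swap_vars i (swap_vars (i + 1) f))"
proof -
  have "swap_mon i (swap_mon (i + 1) (swap_mon i m)) =
        swap_mon (i + 1) (swap_mon i (swap_mon (i + 1) m))" for m
    by (rule poly_mapping_eqI, simp only: lookup_swap_mon, simp add: transpose_def)
  then show ?thesis
    by (intro poly_mapping_eqI) (simp add: lookup_swap_vars)
qed

lemma wdeg_swap_vars: "wdeg \<phi> (swap_vars i f) = wdeg (\<lambda>m. \<phi> (swap_mon i m)) f"
proof -
  have "m \<in> Poly_Mapping.keys (swap_vars i f) \<longleftrightarrow> m \<in> swap_mon i ` Poly_Mapping.keys f" for m
    unfolding in_keys_iff lookup_swap_vars image_iff by (metis in_keys_iff swap_mon_swap_mon)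
  then have "Poly_Mapping.keys (swap_vars i f) = swap_mon i ` Poly_Mapping.keys f"
    by blast
  then show ?thesis
    by (simp add: wdeg_def image_image)
qed

lemma vdeg_swap_vars: "vdeg j (swap_vars i f) = vdeg (transpose i (i + 1) j) f"
  by (simp add: wdeg_swap_vars lookup_swap_mon)

lemma X_eq_iff [simp]: "X i = X j \<longleftrightarrow> i = j"
proof -
  have "i = j" if "Poly_Mapping.single i 1 = (Poly_Mapping.single j 1 :: int \<Rightarrow>\<^sub>0 nat)"
    using that by (metis lookup_single_eq lookup_single_not_eq zero_neq_one)
  moreover have "Poly_Mapping.single i 1 = (Poly_Mapping.single j 1 :: int \<Rightarrow>\<^sub>0 nat)" if "X i = X j"
    using that unfolding X_def by (metis lookup_single_eq lookup_single_not_eq zero_neq_one)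
  ultimately show ?thesis by blast
qed

lemma X_diff_cancel: "(X i - X (i + 1)) * f = (X i - X (i + 1)) * g \<longleftrightarrow> f = g"
  by simp

lemma single_monomial_induct [case_names zero step]:
  fixes m :: "int \<Rightarrow>\<^sub>0 nat"
  assumes "P 0" and "\<And>m j. P m \<Longrightarrow> P (Poly_Mapping.single j 1 + m)"
  shows "P m"
proof (induction m rule: update_induct)
  case (update m j n)
  have "P (Poly_Mapping.single j k + m)" for k
  proof (induction k)
    case (Suc k)
    have "Poly_Mapping.single j (Suc k) + m = Poly_Mapping.single j 1 + (Poly_Mapping.single j k + m)"
      by (simp add: add.assoc[symmetric] flip: single_add)
    then show ?case
      using assms(2) Suc by metis
  qed (use update in simp)
  moreover have "Poly_Mapping.update j n m = Poly_Mapping.single j n + m"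
    using update by (intro poly_mapping_eqI)
      (auto simp: lookup_update lookup_add lookup_single when_def in_keys_iff)
  ultimately show ?case by simp
qed (use assms in simp)

text \<open>Monomials are built one variable at a time, and the step is the Leibniz rule: the
  difference for X j * f is the difference for X j times f, plus the swapped X j times the
  difference for f.\<close>

lemma divdiff_exists: "\<exists>g. (X i - X (i + 1)) * g = f - swap_vars i f"
proof (induction f rule: mpoly_additive_induct)
  case (single m c)
  show ?case
  proof (induction m rule: single_monomial_induct)
    case zero
    then show ?case
      by (intro exI[of _ 0]) (simp add: swap_vars_single)
  next
    case (step m j)
    then obtain g where g: "(X i - X (i + 1)) * g =
        Poly_Mapping.single m c - swap_vars i (Poly_Mapping.single m c)" by blast
    have "\<exists>h. (X i - X (i + 1)) * h = X j - swap_vars i (X j)"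
    proof -
      consider "j = i" | "j = i + 1" | "j \<noteq> i" "j \<noteq> i + 1" by blast
      then show ?thesis
      proof cases
        case 1
        then show ?thesis by (intro exI[of _ 1]) (simp add: swap_vars_X)
      next
        case 2
        then show ?thesis by (intro exI[of _ "-1"]) (simp add: swap_vars_X)
      next
        case 3
        then show ?thesis by (intro exI[of _ 0]) (simp add: swap_vars_X)
      qed
    qed
    then obtain h where h: "(X i - X (i + 1)) * h = X j - swap_vars i (X j)" by blast
    have "Poly_Mapping.single (Poly_Mapping.single j 1 + m) c = X j * Poly_Mapping.single m c"
      by (simp add: X_def mult_single)
    moreover have "(X i - X (i + 1)) * (h * Poly_Mapping.single m c + swap_vars i (X j) * g)
      = X j * Poly_Mapping.single m c - swap_vars i (X j * Poly_Mapping.single m c)"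
      using g h unfolding swap_vars_mult by algebra
    ultimately show ?case by metis
  qed
next
  case (add f g)
  then obtain a b where "(X i - X (i + 1)) * a = f - swap_vars i f"
    "(X i - X (i + 1)) * b = g - swap_vars i g" by blast
  then have "(X i - X (i + 1)) * (a + b) = f + g - swap_vars i (f + g)"
    by (simp add: swap_vars_add distrib_left)
  then show ?case by blast
qed

text \<open>Existence and cancellation give the definite description its meaning; from here on this
  equation and \<open>divdiff_eqI\<close> take the place of the definition.\<close>

lemma divdiff_mult: "(X i - X (i + 1)) * divdiff i f = f - swap_vars i f"
  unfolding divdiff_def
  by (rule theI') (metis divdiff_exists X_diff_cancel)

lemma divdiff_eqI: "(X i - X (i + 1)) * g = f - swap_vars i f \<Longrightarrow> divdiff i f = g"
  using divdiff_mult X_diff_cancel by metis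

lemma divdiff_add: "divdiff i (f + g) = divdiff i f + divdiff i g"
  by (rule divdiff_eqI) (simp add: distrib_left divdiff_mult swap_vars_add)

lemma divdiff_diff: "divdiff i (f - g) = divdiff i f - divdiff i g"
  by (rule divdiff_eqI) (simp add: right_diff_distrib divdiff_mult swap_vars_diff)

lemma divdiff_zero [simp]: "divdiff i 0 = 0"
  by (rule divdiff_eqI) simp

lemma divdiff_sum: "divdiff i (sum f A) = (\<Sum>x\<in>A. divdiff i (f x))"
  by (induction A rule: infinite_finite_induct) (auto simp: divdiff_add)

lemma divdiff_mult_symmetric:
  assumes "swap_vars i f = f"
  shows "divdiff i (f * g) = f * divdiff i g"
proof (rule divdiff_eqI)
  show "(X i - X (i + 1)) * (f * divdiff i g) = f * g - swap_vars i (f * g)"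
    using divdiff_mult[of i g] assms unfolding swap_vars_mult by algebra
qed

lemma divdiff_of_int_mult: "divdiff i (of_int c * f) = of_int c * divdiff i f"
  by (rule divdiff_mult_symmetric) simp

lemma divdiff_eq_zero_iff: "divdiff i f = 0 \<longleftrightarrow> swap_vars i f = f"
  using divdiff_mult[of i f] divdiff_eqI[of i 0 f] by auto

text \<open>Numerator and denominator of the quotient both change sign under the swap.\<close>

lemma swap_vars_divdiff: "swap_vars i (divdiff i f) = divdiff i f"
proof -
  have "(X (i + 1) - X i) * swap_vars i (divdiff i f) = swap_vars i f - f"
    using arg_cong[OF divdiff_mult[of i f], of "swap_vars i"]
    by (simp add: swap_vars_mult swap_vars_diff swap_vars_X)
  then have "(X i - X (i + 1)) * swap_vars i (divdiff i f) = f - swap_vars i f"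
    by algebra
  then show ?thesis
    using divdiff_eqI by metis
qed

lemma divdiff_divdiff [simp]: "divdiff i (divdiff i f) = 0"
  by (simp add: divdiff_eq_zero_iff swap_vars_divdiff)

text \<open>After clearing the two denominators, either side is the signed sum of f over the group
  generated by the two commuting swaps.\<close>

lemma divdiff_commute:
  assumes "\<bar>i - k\<bar> \<ge> 2"
  shows "divdiff i (divdiff k f) = divdiff k (divdiff i f)"
proof -
  have com: "swap_vars i (swap_vars k f) = swap_vars k (swap_vars i f)" for f
    by (rule swap_vars_commute) (use assms in \<open>auto simp: transpose_def\<close>)
  have *: "(X i - X (i + 1)) * ((X k - X (k + 1)) * divdiff i (divdiff k f)) =
    f - swap_vars i f - swap_vars k f + swap_vars i (swap_vars k f)"
    if "\<bar>i - k\<bar> \<ge> 2" for i k and f :: int_mpoly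
  proof -
    have "(X k - X (k + 1)) * swap_vars i (divdiff k f) = swap_vars i f - swap_vars i (swap_vars k f)"
      using that arg_cong[OF divdiff_mult[of k f], of "swap_vars i"]
      by (simp add: swap_vars_mult swap_vars_diff swap_vars_X transpose_def split: if_splits)
    then show ?thesis
      using divdiff_mult[of k f] divdiff_mult[of i "divdiff k f"] by algebra
  qed
  have "(X k - X (k + 1)) * ((X i - X (i + 1)) * divdiff k (divdiff i f)) =
    f - swap_vars k f - swap_vars i f + swap_vars k (swap_vars i f)"
    using assms by (intro *) (simp add: abs_minus_commute)
  with *[OF assms, of f] com[of f]
  have "(X i - X (i + 1)) * ((X k - X (k + 1)) * divdiff i (divdiff k f)) =
        (X i - X (i + 1)) * ((X k - X (k + 1)) * divdiff k (divdiff i f))"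
    by algebra
  then show ?thesis
    unfolding X_diff_cancel .
qed

text \<open>Multiplied by the Vandermonde product (a - b)(a - c)(b - c), either side becomes the
  alternating sum of f over the six permutations of the three variables.\<close>

lemma divdiff_braid:
  "divdiff i (divdiff (i + 1) (divdiff i f)) = divdiff (i + 1) (divdiff i (divdiff (i + 1) f))"
proof -
  define a b c where "a = X i" and "b = X (i + 1)" and "c = X (i + 2)"
  define s t where "s = swap_vars i" and "t = swap_vars (i + 1)"
  define P Q where "P = divdiff i" and "Q = divdiff (i + 1)"
  have P: "(a - b) * P f = f - s f" for f
    by (simp add: P_def a_def b_def s_def divdiff_mult)
  have Q: "(b - c) * Q f = f - t f" for f
    using divdiff_mult[of "i + 1" f] by (simp add: Q_def b_def c_def t_def add.commute)
  have s: "s a = b" "s b = a" "s c = c" and t: "t a = a" "t b = c" "t c = b"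
    by (simp_all add: s_def t_def a_def b_def c_def swap_vars_X transpose_def)
  have hom: "s (f * g) = s f * s g" "t (f * g) = t f * t g"
    "s (f - g) = s f - s g" "t (f - g) = t f - t g" for f g
    by (simp_all add: s_def t_def swap_vars_mult swap_vars_diff)
  have inv: "s (P f) = P f" "t (Q f) = Q f" for f
    by (simp_all add: s_def t_def P_def Q_def swap_vars_divdiff)
  have nz: "a - b \<noteq> 0" "b - c \<noteq> 0" "a - c \<noteq> 0"
    by (simp_all add: a_def b_def c_def)
  \<comment> \<open>Applying \<open>t\<close> turns the denominator a - b into a - c, and applying
    \<open>s\<close> turns b - c into a - c; the next two facts continue in this way.\<close>
  have tP: "(a - c) * t (P f) = t f - t (s f)" and sQ: "(a - c) * s (Q f) = s f - s (t f)" for f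
    using arg_cong[OF P[of f], of t] arg_cong[OF Q[of f], of s] by (simp_all add: hom s t)
  have stP: "(b - c) * s (t (P f)) = s (t f) - s (t (s f))" for f
    using arg_cong[OF tP[of f], of s] by (simp add: hom s)
  have tsQ: "(a - b) * t (s (Q f)) = t (s f) - t (s (t f))" for f
    using arg_cong[OF sQ[of f], of t] by (simp add: hom t)
  have "(a - b) * (a - c) * (b - c) * P (Q (P f)) =
        f - s f - t f + t (s f) + s (t f) - s (t (s f))"
  proof -
    have 1: "(a - b) * P (Q (P f)) = Q (P f) - s (Q (P f))" by (rule P)
    have 2: "(b - c) * Q (P f) = P f - t (P f)" by (rule Q)
    have 3: "(a - c) * s (Q (P f)) = P f - s (t (P f))"
      using sQ[of "P f"] by (simp add: inv)
    show ?thesis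
      using 1 2 3 P[of f] tP[of f] stP[of f] by algebra
  qed
  moreover have "(a - b) * (a - c) * (b - c) * Q (P (Q f)) =
        f - s f - t f + t (s f) + s (t f) - t (s (t f))"
  proof -
    have 1: "(b - c) * Q (P (Q f)) = P (Q f) - t (P (Q f))" by (rule Q)
    have 2: "(a - b) * P (Q f) = Q f - s (Q f)" by (rule P)
    have 3: "(a - c) * t (P (Q f)) = Q f - t (s (Q f))"
      using tP[of "Q f"] by (simp add: inv)
    show ?thesis
      using 1 2 3 Q[of f] sQ[of f] tsQ[of f] by algebra
  qed
  moreover have "s (t (s f)) = t (s (t f))"
    by (simp add: s_def t_def swap_vars_braid)
  ultimately have "(a - b) * (a - c) * (b - c) * P (Q (P f)) = (a - b) * (a - c) * (b - c) * Q (P (Q f))"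
    by simp
  then show ?thesis
    using nz by (simp add: P_def Q_def)
qed

section \<open>Effect of divided differences on the degrees in single variables\<close>

lemma keys_X_diff:
  "Poly_Mapping.keys (X i - X (i + 1)) = {Poly_Mapping.single i 1, Poly_Mapping.single (i + 1) 1}"
proof -
  have "Poly_Mapping.single i 1 \<noteq> (Poly_Mapping.single (i + 1) 1 :: int \<Rightarrow>\<^sub>0 nat)"
    by (metis lookup_single_eq lookup_single_not_eq zero_neq_one less_add_one less_irrefl)
  then have "Poly_Mapping.lookup (X i - X (i + 1)) m = (if m = Poly_Mapping.single i 1 then 1
     else if m = Poly_Mapping.single (i + 1) 1 then -1 else 0)" for m
    by (auto simp: X_def lookup_minus lookup_single when_def)
  then show ?thesis
    by (auto simp: in_keys_iff split: if_splits)
qed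

lemma vdeg_X_diff: "vdeg j (X i - X (i + 1)) = (if j = i \<or> j = i + 1 then 1 else 0)"
  by (auto simp: wdeg_def keys_X_diff lookup_single when_def)

lemma vdeg_divdiff_other:
  assumes "j \<noteq> i" "j \<noteq> i + 1"
  shows "vdeg j (divdiff i f) \<le> vdeg j f"
proof (cases "divdiff i f = 0")
  case False
  have "vdeg j (divdiff i f) = vdeg j (f - swap_vars i f)"
    using vdeg_mult[OF _ False, of "X i - X (i + 1)" j] assms
    by (simp add: divdiff_mult vdeg_X_diff)
  also have "\<dots> \<le> vdeg j f"
    using wdeg_diff_le[of "\<lambda>m. Poly_Mapping.lookup m j" f "swap_vars i f"] assms by (simp add: vdeg_swap_vars)
  finally show ?thesis .
qed simp

text \<open>The swap exchanges the degrees in the two variables, whence the maximum; the factor X i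
  - X (i + 1) has degree 1 in both, whence the strict inequality.\<close>

lemma vdeg_divdiff_same:
  assumes "j = i \<or> j = i + 1" "divdiff i f \<noteq> 0"
  shows "vdeg j (divdiff i f) < max (vdeg i f) (vdeg (i + 1) f)"
proof -
  have "vdeg j (divdiff i f) + 1 = vdeg j (f - swap_vars i f)"
    using vdeg_mult[OF _ assms(2), of "X i - X (i + 1)" j] assms(1)
    by (simp add: divdiff_mult vdeg_X_diff)
  also have "\<dots> \<le> max (vdeg i f) (vdeg (i + 1) f)"
    using wdeg_diff_le[of "\<lambda>m. Poly_Mapping.lookup m j" f "swap_vars i f"] assms(1) by (auto simp: vdeg_swap_vars)
  finally show ?thesis by simp
qed

lemma divdiff_eq_zeroI: "vdeg i f = 0 \<Longrightarrow> vdeg (i + 1) f = 0 \<Longrightarrow> divdiff i f = 0"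
  using vdeg_divdiff_same[of i i f] by auto

subsection \<open>Finitely supported permutations and descents\<close>

abbreviation adj :: "int \<Rightarrow> int \<Rightarrow> int" where
  "adj i \<equiv> transpose i (i + 1)"

lemma adj_comp_adj [simp]: "w \<circ> adj i \<circ> adj i = w"
  by (simp add: fun_eq_iff)

lemma S_pos_inj: "w \<in> S_pos \<Longrightarrow> w a = w b \<longleftrightarrow> a = b"
  by (auto simp: S_pos_def dest: permutes_inj injD)

lemma S_pos_nonpos: "w \<in> S_pos \<Longrightarrow> j < 1 \<Longrightarrow> w j = j"
  by (auto simp: S_pos_def permutes_def)

lemma S_pos_ge_1: "w \<in> S_pos \<Longrightarrow> w j \<ge> 1 \<longleftrightarrow> j \<ge> 1"
  using permutes_in_image[of w "{1..}" j] by (simp add: S_pos_def)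

lemma S_pos_comp: "u \<in> S_pos \<Longrightarrow> v \<in> S_pos \<Longrightarrow> u \<circ> v \<in> S_pos"
proof -
  assume *: "u \<in> S_pos" "v \<in> S_pos"
  then have "finite ({j. u j \<noteq> j} \<union> {j. v j \<noteq> j})"
    by (simp add: S_pos_def)
  then have "finite {j. (u \<circ> v) j \<noteq> j}"
    by (rule rev_finite_subset) auto
  then show ?thesis
    using * by (simp add: S_pos_def permutes_compose)
qed

lemma adj_in_S_pos: "i \<ge> 1 \<Longrightarrow> adj i \<in> S_pos"
  unfolding S_pos_def
  by (auto intro!: permutes_swap_id finite_subset[of _ "{i, i + 1}"] simp: transpose_def)

lemma S_pos_comp_adj: "w \<in> S_pos \<Longrightarrow> i \<ge> 1 \<Longrightarrow> w \<circ> adj i \<in> S_pos"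
  by (intro S_pos_comp adj_in_S_pos)

lemma id_in_S_pos: "id \<in> S_pos"
  by (simp add: S_pos_def permutes_id)

lemma S_fin_in_S_pos: "w \<in> S_fin n \<Longrightarrow> w \<in> S_pos"
  by (simp add: S_fin_def)

lemma S_fin_mono: "w \<in> S_fin n \<Longrightarrow> n \<le> m \<Longrightarrow> w \<in> S_fin m"
  by (auto simp: S_fin_def)

lemma id_in_S_fin: "id \<in> S_fin n"
  by (simp add: S_fin_def id_in_S_pos)

lemma S_fin_comp: "u \<in> S_fin n \<Longrightarrow> v \<in> S_fin n \<Longrightarrow> u \<circ> v \<in> S_fin n"
  by (auto simp: S_fin_def S_pos_comp)

lemma adj_in_S_fin: "1 \<le> i \<Longrightarrow> i < int n \<Longrightarrow> adj i \<in> S_fin n"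
  by (auto simp: S_fin_def adj_in_S_pos transpose_def)

lemma S_fin_le:
  assumes "w \<in> S_fin n" "j \<le> int n"
  shows "w j \<le> int n"
proof (rule ccontr)
  assume "\<not> w j \<le> int n"
  then have "w (w j) = w j"
    using assms by (simp add: S_fin_def)
  then show False
    using assms \<open>\<not> w j \<le> int n\<close> S_pos_inj S_fin_in_S_pos by metis
qed

lemma S_fin_descent:
  assumes "w \<in> S_fin n" "w i > w (i + 1)"
  shows "i < int n"
proof (rule ccontr)
  assume *: "\<not> i < int n"
  then have "w (i + 1) = i + 1"
    using assms by (simp add: S_fin_def)
  moreover have "w i \<le> i"
    using * S_fin_le[OF S_fin_mono[OF assms(1), of "nat i"], of i] by auto
  ultimately show False
    using assms by simp
qed

lemma S_pos_imp_S_fin: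
  assumes "w \<in> S_pos"
  obtains n where "n \<ge> 1" "w \<in> S_fin n"
proof -
  obtain b where "\<And>j. w j \<noteq> j \<Longrightarrow> j \<le> b"
    using assms bdd_above_finite[of "{j. w j \<noteq> j}"] by (auto simp: S_pos_def bdd_above_def)
  then have "w \<in> S_fin (nat (max 1 b))"
    using assms by (force simp: S_fin_def)
  then show thesis
    using that[of "nat (max 1 b)"] by simp
qed

lemma finite_S_fin: "finite (S_fin n)"
proof (rule finite_subset)
  show "S_fin n \<subseteq> {w. w permutes {1..int n}}"
  proof
    fix w assume w: "w \<in> S_fin n"
    have "w permutes {1..}" using w by (simp add: S_fin_def S_pos_def)
    moreover have "w j = j" if "j \<notin> {1..int n}" for j
      using that w by (cases "j < 1") (auto simp: S_fin_def S_pos_nonpos)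
    ultimately show "w \<in> {w. w permutes {1..int n}}"
      by (simp add: permutes_def)
  qed
qed (simp add: finite_permutations)

text \<open>A measure that decreases along descents, in the role of the Coxeter length. Being a sum
  over the moved points, it is easy to update under an adjacent exchange.\<close>

definition disp :: "(int \<Rightarrow> int) \<Rightarrow> nat" where
  "disp w = nat (\<Sum>j | w j \<noteq> j. (j - w j)\<^sup>2)"

lemma disp_eq:
  assumes "finite A" "{j. w j \<noteq> j} \<subseteq> A"
  shows "disp w = nat (\<Sum>j\<in>A. (j - w j)\<^sup>2)"
  unfolding disp_def using assms by (intro arg_cong[of _ _ nat] sum.mono_neutral_left) auto

text \<open>Only the summands at i and i + 1 change, and the sum of squares drops by 2 (w i - w (i +
  1)).\<close>

lemma disp_descent:
  assumes "w \<in> S_pos" "w i > w (i + 1)"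
  shows "disp (w \<circ> adj i) < disp w"
proof -
  define A where "A = {j. w j \<noteq> j} - {i, i + 1}"
  have fin: "finite A"
    using assms by (simp add: A_def S_pos_def)
  have notin: "i \<notin> A" "i + 1 \<notin> A"
    by (auto simp: A_def)
  let ?B = "insert i (insert (i + 1) A)"
  have sum: "(\<Sum>j\<in>?B. f j) = f i + (f (i + 1) + (\<Sum>j\<in>A. f j))" for f :: "int \<Rightarrow> int"
    using fin notin by simp
  have "disp w = nat ((i - w i)\<^sup>2 + ((i + 1 - w (i + 1))\<^sup>2 + (\<Sum>j\<in>A. (j - w j)\<^sup>2)))"
    by (subst disp_eq[of ?B]) (use fin in \<open>auto simp: sum A_def\<close>)
  moreover have "disp (w \<circ> adj i) =
      nat ((i - w (i + 1))\<^sup>2 + ((i + 1 - w i)\<^sup>2 + (\<Sum>j\<in>A. (j - w j)\<^sup>2)))"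
  proof -
    have "(\<Sum>j\<in>A. (j - w (adj i j))\<^sup>2) = (\<Sum>j\<in>A. (j - w j)\<^sup>2)"
      by (rule sum.cong) (auto simp: A_def transpose_def)
    then show ?thesis
      by (subst disp_eq[of ?B]) (use fin in \<open>auto simp: sum A_def transpose_def\<close>)
  qed
  moreover have "(i - w (i + 1))\<^sup>2 + (i + 1 - w i)\<^sup>2 < (i - w i)\<^sup>2 + (i + 1 - w (i + 1))\<^sup>2"
    using assms(2) by (simp add: power2_eq_square algebra_simps)
  moreover have "(\<Sum>j\<in>A. (j - w j)\<^sup>2) \<ge> 0"
    by (simp add: sum_nonneg)
  moreover have "nat a < nat b" if "0 \<le> a" "a < b" for a b :: int
    using that by simp
  ultimately show ?thesis
    by (metis (no_types, lifting) add.assoc add_less_cancel_right add_nonneg_nonneg zero_le_power2)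
qed

text \<open>An increasing w with w 1 \<ge> 1 satisfies w j \<ge> j at positive j, but the largest
  moved point cannot be moved upwards, as its image is again a moved point.\<close>

lemma no_descent_imp_id:
  assumes w: "w \<in> S_pos" and asc: "\<And>i. i \<ge> 1 \<Longrightarrow> \<not> w i > w (i + 1)"
  shows "w = id"
proof (rule ccontr)
  assume "w \<noteq> id"
  define M where "M = {j. w j \<noteq> j}"
  have M: "finite M" "M \<noteq> {}"
    using w \<open>w \<noteq> id\<close> by (auto simp: M_def S_pos_def fun_eq_iff)
  have ge: "w j \<ge> j" if "j \<ge> 1" for j
    using that
  proof (induction j rule: int_ge_induct)
    case base
    then show ?case using S_pos_ge_1[OF w, of 1] by simp
  next
    case (step i)
    then show ?case
      using asc[of i] S_pos_inj[OF w, of i "i + 1"] by linarith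
  qed
  have "Max M \<in> M"
    using M by (rule Max_in)
  then have 1: "w (Max M) \<noteq> Max M"
    by (simp add: M_def)
  then have "w (Max M) \<in> M"
    using S_pos_inj[OF w] by (simp add: M_def)
  then have "w (Max M) \<le> Max M"
    using M by simp
  moreover have "Max M \<ge> 1"
    using 1 S_pos_nonpos[OF w] by force
  ultimately show False
    using ge[of "Max M"] 1 by simp
qed

text \<open>For operators satisfying the braid relations, applying them along a chain of descents from
  \<open>w\<close> to the identity gives a result independent of the chain.\<close>

function braid_word :: "(int \<Rightarrow> 'b \<Rightarrow> 'b) \<Rightarrow> 'b \<Rightarrow> (int \<Rightarrow> int) \<Rightarrow> 'b" where
  "braid_word R e w = (if w \<in> S_pos \<and> (\<exists>i\<ge>1. w i > w (i + 1))
     then (let i = (SOME i. i \<ge> 1 \<and> w i > w (i + 1)) in R i (braid_word R e (w \<circ> adj i))) else e)"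
  by pat_completeness auto
termination
proof (relation "measure (\<lambda>(R, e, w). disp w)", goal_cases)
  case (2 R e w i)
  then have "i \<ge> 1 \<and> w i > w (i + 1)"
    using someI_ex[of "\<lambda>i. i \<ge> 1 \<and> w i > w (i + 1)"] by auto
  then show ?case
    using 2 disp_descent by simp
qed simp

declare braid_word.simps [simp del]

lemma braid_word_id: "braid_word R e id = e"
  by (simp add: braid_word.simps)

text \<open>A diamond argument by induction on \<open>disp\<close>: the descent k picked by the
  definition and the given i coincide, are neighbours, or are far apart. In the latter two cases
  both chains are prolonged to a common permutation, where the relations compare them. The type of
  values is left open because polynomials and operators on polynomials both occur.\<close>

lemma braid_word_descent:
  assumes far: "\<And>i k b. \<bar>i - k\<bar> \<ge> 2 \<Longrightarrow> R i (R k b) = R k (R i b)"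
    and near: "\<And>i b. R i (R (i + 1) (R i b)) = R (i + 1) (R i (R (i + 1) b))"
    and "w \<in> S_pos" "i \<ge> 1" "w i > w (i + 1)"
  shows "braid_word R e w = R i (braid_word R e (w \<circ> adj i))"
  using assms(3-5)
proof (induction w arbitrary: i rule: measure_induct_rule[of disp])
  case (less w)
  let ?D = "braid_word R e"
  define k where "k = (SOME i. i \<ge> 1 \<and> w i > w (i + 1))"
  have k: "k \<ge> 1" "w k > w (k + 1)"
    using someI_ex[of "\<lambda>i. i \<ge> 1 \<and> w i > w (i + 1)"] less.prems by (auto simp: k_def)
  have Dk: "?D w = R k (?D (w \<circ> adj k))"
    using less.prems by (subst braid_word.simps) (auto simp: k_def Let_def)
  have IH: "?D w' = R j (?D (w' \<circ> adj j))"
    if "disp w' < disp w" "w' \<in> S_pos" "j \<ge> 1" "w' j > w' (j + 1)" for w' j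
    using less.IH that by blast
  \<comment> \<open>Two consecutive descents start two chains of length three; both end at w with
    the values at a and a + 2 exchanged.\<close>
  have adjacent: "R a (?D (w \<circ> adj a)) = R (a + 1) (?D (w \<circ> adj (a + 1)))"
    if a: "a \<ge> 1" "w a > w (a + 1)" "w (a + 1) > w (a + 1 + 1)" for a
  proof -
    let ?s = "adj a" and ?t = "adj (a + 1)"
    have S: "w \<circ> ?s \<in> S_pos" "w \<circ> ?s \<circ> ?t \<in> S_pos" "w \<circ> ?t \<in> S_pos" "w \<circ> ?t \<circ> ?s \<in> S_pos"
      using S_pos_comp_adj[of _ a] S_pos_comp_adj[of _ "a + 1"] less.prems(1) a(1) by auto
    have d1: "disp (w \<circ> ?s) < disp w" and d2: "disp (w \<circ> ?t) < disp w"
      using a less.prems(1) disp_descent by blast+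
    have d3: "disp (w \<circ> ?s \<circ> ?t) < disp (w \<circ> ?s)" "disp (w \<circ> ?t \<circ> ?s) < disp (w \<circ> ?t)"
      using a S by (intro disp_descent; simp add: transpose_def)+
    have "?D (w \<circ> ?s) = R (a + 1) (?D (w \<circ> ?s \<circ> ?t))" "?D (w \<circ> ?t) = R a (?D (w \<circ> ?t \<circ> ?s))"
      by (rule IH; use a S d1 d2 in \<open>simp add: transpose_def\<close>)+
    moreover have "?D (w \<circ> ?s \<circ> ?t) = R a (?D (w \<circ> ?s \<circ> ?t \<circ> ?s))"
      "?D (w \<circ> ?t \<circ> ?s) = R (a + 1) (?D (w \<circ> ?t \<circ> ?s \<circ> ?t))"
      by (rule IH; use a S d1 d2 d3 in \<open>simp add: transpose_def\<close>)+
    moreover have "w \<circ> ?s \<circ> ?t \<circ> ?s = w \<circ> ?t \<circ> ?s \<circ> ?t"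
      by (auto simp: fun_eq_iff transpose_def)
    ultimately show ?thesis
      by (simp add: near)
  qed
  consider "i = k" | "i = k + 1" | "k = i + 1" | "\<bar>i - k\<bar> \<ge> 2" by linarith
  then show ?case
  proof cases
    case 1
    then show ?thesis using Dk by metis
  next
    case 2
    then show ?thesis using Dk adjacent[of k] k less.prems by metis
  next
    case 3
    then show ?thesis using Dk adjacent[of i] k less.prems by metis
  next
    case 4
    have "?D (w \<circ> adj k) = R i (?D (w \<circ> adj k \<circ> adj i))"
      by (rule IH) (use 4 k less.prems in \<open>auto simp: disp_descent S_pos_comp_adj transpose_def\<close>)
    moreover have "?D (w \<circ> adj i) = R k (?D (w \<circ> adj i \<circ> adj k))"
      by (rule IH) (use 4 k less.prems in \<open>auto simp: disp_descent S_pos_comp_adj transpose_def\<close>)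
    moreover have "w \<circ> adj k \<circ> adj i = w \<circ> adj i \<circ> adj k"
      using 4 by (auto simp: fun_eq_iff transpose_def)
    ultimately show ?thesis
      using Dk far[OF 4] by metis
  qed
qed

subsection \<open>Schubert polynomials\<close>

definition top_monomial :: "nat \<Rightarrow> int_mpoly" where
  "top_monomial n = (\<Prod>i = 1..n. X (int i) ^ (n - i))"

text \<open>Composing with the longest element turns ascents of w into descents, so a chain of
  descents from \<open>longest n \<circ> w\<close> to the identity is a chain of ascents from w up
  to \<open>longest n\<close>, where the top monomial sits.\<close>

definition schubert_from :: "nat \<Rightarrow> (int \<Rightarrow> int) \<Rightarrow> int_mpoly" where
  "schubert_from n w = braid_word divdiff (top_monomial n) (longest n \<circ> w)"

lemma longest_longest [simp]: "longest n (longest n j) = j"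
  by (auto simp: longest_def)

lemma longest_comp_longest [simp]: "longest n \<circ> (longest n \<circ> w) = w"
  by (simp add: fun_eq_iff)

lemma longest_in_S_fin: "longest n \<in> S_fin n"
proof -
  have "longest n permutes {1..}"
    by (rule bij_imp_permutes[OF bij_betwI[where g = "longest n"]]) (auto simp: longest_def)
  moreover have "finite {j. longest n j \<noteq> j}"
    by (rule finite_subset[of _ "{1..int n}"]) (auto simp: longest_def)
  ultimately show ?thesis
    by (auto simp: S_fin_def S_pos_def longest_def)
qed

lemma schubert_from_longest: "schubert_from n (longest n) = top_monomial n"
proof -
  have "longest n \<circ> longest n = id" by (simp add: fun_eq_iff)
  then show ?thesis by (simp add: schubert_from_def braid_word_id)
qed

lemma longest_less_iff:
  assumes "w \<in> S_fin n" "1 \<le> i" "i < int n"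
  shows "longest n (w i) > longest n (w (i + 1)) \<longleftrightarrow> w i < w (i + 1)"
proof -
  have "w i \<le> int n" "w (i + 1) \<le> int n" "w i \<ge> 1" "w (i + 1) \<ge> 1"
    using assms S_fin_le[of w n i] S_fin_le[of w n "i + 1"] S_pos_ge_1[OF S_fin_in_S_pos[OF assms(1)]]
    by auto
  then show ?thesis
    by (simp add: longest_def)
qed

lemma schubert_from_descent:
  assumes w: "w \<in> S_fin n" and i: "i \<ge> 1" "w i > w (i + 1)"
  shows "schubert_from n (w \<circ> adj i) = divdiff i (schubert_from n w)"
proof -
  have "i < int n"
    using S_fin_descent w i by blast
  let ?y = "longest n \<circ> (w \<circ> adj i)"
  have w': "w \<circ> adj i \<in> S_fin n"
    using w i \<open>i < int n\<close> by (intro S_fin_comp adj_in_S_fin)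
  have "?y \<in> S_pos"
    using w' longest_in_S_fin S_fin_comp S_fin_in_S_pos by blast
  moreover have "?y i > ?y (i + 1)"
    using longest_less_iff[OF w', of i] i \<open>i < int n\<close> by simp
  ultimately have "braid_word divdiff (top_monomial n) ?y =
      divdiff i (braid_word divdiff (top_monomial n) (?y \<circ> adj i))"
    using i by (intro braid_word_descent divdiff_commute divdiff_braid)
  moreover have "?y \<circ> adj i = longest n \<circ> w"
    by (simp add: fun_eq_iff)
  ultimately show ?thesis
    by (simp add: schubert_from_def)
qed

text \<open>The measure is \<open>disp\<close> of \<open>longest n \<circ> w\<close>: as long as
  this is not the identity it has a descent, which is an ascent of w, and exchanging there brings w
  closer to the longest element.\<close>

lemma S_fin_induct [consumes 1, case_names longest descent]:
  assumes "w \<in> S_fin n" and "P (longest n)"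
    and "\<And>w i. w \<in> S_fin n \<Longrightarrow> P w \<Longrightarrow> i \<ge> 1 \<Longrightarrow> i < int n \<Longrightarrow> w i > w (i + 1) \<Longrightarrow> P (w \<circ> adj i)"
  shows "P w"
  using assms(1)
proof (induction w rule: measure_induct_rule[of "\<lambda>w. disp (longest n \<circ> w)"])
  case (less w)
  let ?y = "longest n \<circ> w"
  have yf: "?y \<in> S_fin n"
    using less.prems longest_in_S_fin S_fin_comp by blast
  then have y: "?y \<in> S_pos"
    by (rule S_fin_in_S_pos)
  show ?case
  proof (cases "\<exists>i\<ge>1. ?y i > ?y (i + 1)")
    case False
    then have "?y = id"
      using no_descent_imp_id[OF y] by blast
    then have "w = longest n"
      by (metis comp_id longest_comp_longest)
    then show ?thesis using assms(2) by simp
  next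
    case True
    then obtain i where i: "i \<ge> 1" "?y i > ?y (i + 1)" by blast
    then have "i < int n"
      using S_fin_descent[OF yf] by blast
    then have asc: "w i < w (i + 1)"
      using longest_less_iff[OF less.prems, of i] i by simp
    have w': "w \<circ> adj i \<in> S_fin n"
      using less.prems i \<open>i < int n\<close> by (intro S_fin_comp adj_in_S_fin)
    have "disp (longest n \<circ> (w \<circ> adj i)) < disp ?y"
      using disp_descent[OF y i(2)] by (simp add: comp_def)
    then have "P (w \<circ> adj i)"
      using less.IH w' by blast
    then have "P (w \<circ> adj i \<circ> adj i)"
      using assms(3)[OF w', of i] i asc \<open>i < int n\<close> by (metis comp_apply transpose_apply_first transpose_apply_second)
    then show ?thesis by (metis adj_comp_adj)
  qed
qed

section \<open>Independence of n, and the Schubert polynomial as a function of w\<close>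

lemma swap_vars_prod: "swap_vars i (prod f A) = (\<Prod>x\<in>A. swap_vars i (f x))"
  by (induction A rule: infinite_finite_induct) (auto simp: swap_vars_mult)

text \<open>The chain is explicit. \<open>c k\<close> is the word n, ..., n + 1 - k, n + 1, n - k,
  ..., 1, obtained from the longest element of S_(n+1) by exchanges at 1, ..., k, and
  \<open>p k\<close> is its polynomial. The k-th exchange removes one factor x_k.\<close>

lemma schubert_from_Suc_longest: "schubert_from (Suc n) (longest n) = top_monomial n"
proof -
  define c where "c k j = (if 1 \<le> j \<and> j \<le> int k then int n + 1 - j
    else if j = int k + 1 then int n + 1
    else if int k + 2 \<le> j \<and> j \<le> int n + 1 then int n + 2 - j else j)" for k :: nat and j :: int
  define p where "p k = (\<Prod>i = 1..k. X (int i) ^ (n - i)) * (\<Prod>i = Suc k..Suc n. X (int i) ^ (Suc n - i))" for k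
  have c_Suc: "c (Suc k) = c k \<circ> adj (int (Suc k))" if "k < n" for k
    using that by (auto simp: c_def fun_eq_iff transpose_def)
  have "k \<le> n \<Longrightarrow> c k \<in> S_fin (Suc n) \<and> schubert_from (Suc n) (c k) = p k" for k
  proof (induction k)
    case 0
    have "c 0 = longest (Suc n)"
      by (auto simp: c_def longest_def fun_eq_iff)
    then show ?case
      using longest_in_S_fin[of "Suc n"] by (simp add: schubert_from_longest p_def top_monomial_def)
  next
    case (Suc k)
    let ?i = "int (Suc k)"
    define q where "q = (\<Prod>i = 1..k. X (int i) ^ (n - i)) * (\<Prod>i = Suc (Suc (Suc k))..Suc n. X (int i) ^ (Suc n - i))"
    have ck: "c k \<in> S_fin (Suc n)" "schubert_from (Suc n) (c k) = p k"
      using Suc by simp_all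
    have "c (Suc k) \<in> S_fin (Suc n)"
      unfolding c_Suc[OF Suc_le_lessD[OF Suc.prems]] using Suc.prems
      by (intro S_fin_comp adj_in_S_fin ck) auto
    moreover have "schubert_from (Suc n) (c (Suc k)) = divdiff ?i (p k)"
    proof -
      have "c k ?i > c k (?i + 1)"
        using Suc.prems by (simp add: c_def)
      moreover have "?i \<ge> 1"
        by simp
      ultimately show ?thesis
        unfolding c_Suc[OF Suc_le_lessD[OF Suc.prems]] using schubert_from_descent[OF ck(1), of ?i] ck(2)
        by metis
    qed
    moreover have "divdiff ?i (p k) = p (Suc k)"
    proof -
      \<comment> \<open>The exponents of x_(k+1) and x_(k+2) in \<open>p k\<close> are n - k and n -
        k - 1, so \<open>p k\<close> is x_(k+1) times a polynomial symmetric in these two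
        variables.\<close>
      define r where "r = q * (X ?i * X (?i + 1)) ^ (n - Suc k)"
      have nk: "n - k = Suc (n - Suc k)" "Suc n - Suc k = n - k" "Suc n - Suc (Suc k) = n - Suc k"
        using Suc by auto
      have iv: "{Suc k..Suc n} = insert (Suc k) (insert (Suc (Suc k)) {Suc (Suc (Suc k))..Suc n})"
        "{Suc (Suc k)..Suc n} = insert (Suc (Suc k)) {Suc (Suc (Suc k))..Suc n}"
        using Suc by auto
      have "p k = q * (X ?i ^ (n - k) * X (?i + 1) ^ (n - Suc k))"
        unfolding p_def q_def iv by (simp add: nk algebra_simps del: of_nat_Suc) (simp add: algebra_simps)
      also have "\<dots> = r * X ?i"
        unfolding r_def nk(1) by (simp add: power_mult_distrib algebra_simps del: of_nat_Suc)
      finally have pk: "p k = r * X ?i" .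
      have "p (Suc k) = r"
        unfolding p_def q_def iv r_def by (simp add: nk power_mult_distrib algebra_simps del: of_nat_Suc) (simp add: algebra_simps)
      moreover have "swap_vars ?i q = q"
        unfolding q_def swap_vars_mult swap_vars_prod
        by (intro arg_cong2[of _ _ _ _ "(*)"] prod.cong) (auto simp: swap_vars_power swap_vars_X transpose_def)
      then have "swap_vars ?i r = r"
        by (simp add: r_def swap_vars_mult swap_vars_power swap_vars_X mult.commute)
      moreover have "divdiff ?i (X ?i) = 1"
        by (rule divdiff_eqI) (simp add: swap_vars_X)
      ultimately show ?thesis
        using divdiff_mult_symmetric[of ?i r "X ?i"] pk by simp
    qed
    ultimately show ?case by simp
  qed
  moreover have "c n = longest n"
    by (auto simp: c_def longest_def fun_eq_iff)
  moreover have "p n = top_monomial n"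
    by (simp add: p_def top_monomial_def)
  ultimately show ?thesis by (metis order_refl)
qed

lemma schubert_from_Suc: "w \<in> S_fin n \<Longrightarrow> schubert_from (Suc n) w = schubert_from n w"
proof (induction w rule: S_fin_induct)
  case longest
  then show ?case by (simp add: schubert_from_Suc_longest schubert_from_longest)
next
  case (descent w i)
  then show ?case
    using S_fin_mono[of w n "Suc n"] schubert_from_descent by (metis le_SucI order_refl)
qed

lemma schubert_from_mono: "n \<le> m \<Longrightarrow> w \<in> S_fin n \<Longrightarrow> schubert_from m w = schubert_from n w"
proof (induction m rule: dec_induct)
  case (step m)
  then show ?case
    using schubert_from_Suc[of w m] S_fin_mono[of w n m] by simp
qed simp

lemma schubert_from_indep: "w \<in> S_fin n \<Longrightarrow> w \<in> S_fin m \<Longrightarrow> schubert_from m w = schubert_from n w"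
  using schubert_from_mono by (metis nle_le)

lemma is_schubert_schubert_from: "w \<in> S_fin n \<Longrightarrow> is_schubert w (schubert_from n w)"
proof (induction w rule: S_fin_induct)
  case longest
  then show ?case
    using is_schubert.longest[of n] by (simp add: schubert_from_longest top_monomial_def)
next
  case (descent w i)
  then show ?case
    using is_schubert.descent schubert_from_descent by metis
qed

text \<open>A derivation of \<open>is_schubert\<close> never leaves the S_n it starts in. Together
  with independence of n this gives the uniqueness that the definite description
  \<open>schubert\<close> relies on.\<close>

lemma is_schubert_imp_schubert_from:
  "is_schubert w p \<Longrightarrow> \<exists>n. w \<in> S_fin n \<and> p = schubert_from n w"
proof (induction rule: is_schubert.induct)
  case (longest n)
  then show ?case
    using longest_in_S_fin schubert_from_longest top_monomial_def by metis
next
  case (descent w p i)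
  then obtain n where n: "w \<in> S_fin n" "p = schubert_from n w" by blast
  then have "w \<circ> adj i \<in> S_fin n"
    using descent S_fin_descent by (intro S_fin_comp adj_in_S_fin) auto
  then show ?case
    using n descent schubert_from_descent by metis
qed

lemma schubert_eq: "w \<in> S_fin n \<Longrightarrow> schubert w = schubert_from n w"
  unfolding schubert_def
  by (rule the_equality)
    (auto simp: is_schubert_schubert_from dest!: is_schubert_imp_schubert_from intro: schubert_from_indep)

lemma schubert_id [simp]: "schubert id = 1"
proof -
  have "longest 0 = id"
    by (auto simp: longest_def fun_eq_iff)
  then show ?thesis
    using schubert_from_longest[of 0] schubert_eq[OF id_in_S_fin, of 0] by (simp add: top_monomial_def)
qed

lemma divdiff_schubert_descent:
  assumes "w \<in> S_pos" "i \<ge> 1" "w i > w (i + 1)"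
  shows "divdiff i (schubert w) = schubert (w \<circ> adj i)"
proof -
  obtain n where n: "w \<in> S_fin n"
    using S_pos_imp_S_fin[OF assms(1)] .
  then have "w \<circ> adj i \<in> S_fin n"
    using assms S_fin_descent by (intro S_fin_comp adj_in_S_fin) auto
  then show ?thesis
    using n assms by (simp add: schubert_eq schubert_from_descent)
qed

text \<open>At an ascent the polynomial is itself a divided difference at i, and
  \<open>divdiff i\<close> squares to zero.\<close>

lemma divdiff_schubert_ascent:
  assumes "w \<in> S_pos" "i \<ge> 1" "w i < w (i + 1)"
  shows "divdiff i (schubert w) = 0"
  using divdiff_schubert_descent[of "w \<circ> adj i" i] assms
  by (simp add: S_pos_comp_adj) (metis divdiff_divdiff)

text \<open>Divided differences along descents carry the polynomial to that of the identity, which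
  is 1.\<close>

lemma schubert_nonzero: "w \<in> S_pos \<Longrightarrow> schubert w \<noteq> 0"
proof (induction w rule: measure_induct_rule[of disp])
  case (less w)
  show ?case
  proof (cases "\<exists>i\<ge>1. w i > w (i + 1)")
    case False
    then have "w = id" using no_descent_imp_id less.prems by blast
    then show ?thesis using schubert_id by (metis zero_neq_one)
  next
    case True
    then obtain i where i: "i \<ge> 1" "w i > w (i + 1)" by blast
    then have "schubert (w \<circ> adj i) \<noteq> 0"
      using less disp_descent S_pos_comp_adj by blast
    then show ?thesis
      using divdiff_schubert_descent[OF less.prems i] by auto
  qed
qed

subsection \<open>Staircase polynomials\<close>

text \<open>Equivalently, every monomial divides the staircase monomial. The condition is stated
  variable by variable so that additivity of degrees can decide it for products; \<open>nat\<close>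
  truncates the bound to 0 for j \<ge> n.\<close>

definition staircase :: "nat \<Rightarrow> int_mpoly \<Rightarrow> bool" where
  "staircase n f \<longleftrightarrow> (\<forall>j. vdeg j f \<le> (if j < 1 then 0 else nat (int n - j)))"

lemma staircaseD: "staircase n f \<Longrightarrow> vdeg j f \<le> nat (int n - j)"
  unfolding staircase_def by (drule spec[of _ j]) (simp split: if_splits)

lemma staircase_nonpos: "staircase n f \<Longrightarrow> j < 1 \<Longrightarrow> vdeg j f = 0"
  unfolding staircase_def by (drule spec[of _ j]) simp

lemma staircase_zero: "staircase n 0"
  by (simp add: staircase_def)

lemma staircase_sum:
  assumes "\<And>x. x \<in> A \<Longrightarrow> staircase n (f x)"
  shows "staircase n (sum f A)"
  unfolding staircase_def using assms by (intro allI wdeg_sum_le) (simp add: staircase_def)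

lemma staircase_of_int_mult: "staircase n f \<Longrightarrow> staircase n (of_int c * f)"
  unfolding staircase_def using vdeg_of_int_mult_le order_trans by blast

lemma staircase_diff: "staircase n f \<Longrightarrow> staircase n g \<Longrightarrow> staircase n (f - g)"
  unfolding staircase_def using wdeg_diff_le[of _ f g] by (meson max.bounded_iff order_trans)

lemma staircase_divdiff_zero: "staircase n f \<Longrightarrow> i \<ge> int n \<Longrightarrow> divdiff i f = 0"
  using staircaseD[of n f i] staircaseD[of n f "i + 1"] by (intro divdiff_eq_zeroI) auto

text \<open>The bounds for x_i and x_(i+1) are n - i and n - i - 1, and a drop below their maximum
  is exactly what the smaller bound asks for.\<close>

lemma staircase_divdiff:
  assumes "staircase n f" "i \<ge> 1"
  shows "staircase n (divdiff i f)"
proof (cases "divdiff i f = 0")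
  case True
  then show ?thesis by (simp add: staircase_zero)
next
  case False
  then have i: "i < int n"
    using staircase_divdiff_zero[OF assms(1), of i] by linarith
  show ?thesis
    unfolding staircase_def
  proof
    fix j
    show "vdeg j (divdiff i f) \<le> (if j < 1 then 0 else nat (int n - j))"
    proof (cases "j = i \<or> j = i + 1")
      case True
      then show ?thesis
        using vdeg_divdiff_same[OF True False] staircaseD[OF assms(1), of i]
          staircaseD[OF assms(1), of "i + 1"] i assms(2) by auto
    next
      case False
      then show ?thesis
        using vdeg_divdiff_other[of j i f] staircaseD[OF assms(1), of j] staircase_nonpos[OF assms(1), of j]
        by auto
    qed
  qed
qed

lemma vdeg_mult_le: "vdeg j (f * g) \<le> vdeg j f + vdeg j g"
  using vdeg_mult[of f g j] by (cases "f = 0 \<or> g = 0") auto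

lemma vdeg_prod_le: "vdeg j (prod f A) \<le> (\<Sum>x\<in>A. vdeg j (f x))"
proof (induction A rule: infinite_finite_induct)
  case (insert x A)
  then show ?case
    using vdeg_mult_le[of j "f x" "prod f A"] by simp
qed (auto simp: wdeg_def)

lemma vdeg_X_power_le: "vdeg j (X i ^ k) \<le> (if i = j then k else 0)"
proof (induction k)
  case (Suc k)
  have "vdeg j (X i) \<le> (if i = j then 1 else 0)"
    by (auto simp: wdeg_def X_def lookup_single)
  then show ?case
    using vdeg_mult_le[of j "X i" "X i ^ k"] Suc by (auto split: if_splits)
qed (simp add: wdeg_def)

lemma staircase_top_monomial: "staircase n (top_monomial n)"
  unfolding staircase_def
proof
  fix j
  have "vdeg j (top_monomial n) \<le> (\<Sum>i = 1..n. if int i = j then n - i else 0)"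
    unfolding top_monomial_def
    by (rule order_trans[OF vdeg_prod_le sum_mono]) (rule vdeg_X_power_le)
  also have "\<dots> = (\<Sum>i \<in> {1..n} \<inter> {i. int i = j}. n - i)"
    by (simp add: sum.inter_restrict)
  also have "{1..n} \<inter> {i. int i = j} = (if 1 \<le> j \<and> j \<le> int n then {nat j} else {})"
    by auto
  also have "(\<Sum>i \<in> (if 1 \<le> j \<and> j \<le> int n then {nat j} else {}). n - i) \<le>
      (if j < 1 then 0 else nat (int n - j))"
    by auto
  finally show "vdeg j (top_monomial n) \<le> (if j < 1 then 0 else nat (int n - j))" .
qed

lemma staircase_schubert:
  assumes "w \<in> S_fin n"
  shows "staircase n (schubert w)"
proof -
  have "staircase n (schubert_from n w)"
    using assms
  proof (induction w rule: S_fin_induct)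
    case longest
    then show ?case by (simp add: schubert_from_longest staircase_top_monomial)
  next
    case (descent w i)
    then show ?case
      using schubert_from_descent staircase_divdiff by metis
  qed
  then show ?thesis
    using assms by (simp add: schubert_eq)
qed

text \<open>Invariance makes h symmetric in all variables of positive index, so these have equal
  degrees; far out the degree is 0, so h is constant.\<close>

lemma staircase_invariant_eq_zero:
  assumes h: "staircase n h" and inv: "\<And>i. i \<ge> 1 \<Longrightarrow> divdiff i h = 0"
    and const: "Poly_Mapping.lookup h 0 = 0"
  shows "h = 0"
proof -
  have eq: "vdeg j h = vdeg (j + 1) h" if "j \<ge> 1" for j
    using vdeg_swap_vars[of j j h] inv[OF that] by (simp add: divdiff_eq_zero_iff)
  have shift: "vdeg j h = vdeg (j + int k) h" if "j \<ge> 1" for j k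
  proof (induction k)
    case (Suc k)
    then show ?case
      using eq[of "j + int k"] that by (simp add: ac_simps)
  qed simp
  have "vdeg j h = 0" if "j \<ge> 1" for j
    using that staircaseD[OF h, of "j + int n"] shift[OF that, of n] by simp
  then have "vdeg j h = 0" for j
    using staircase_nonpos[OF h, of j] by (cases "j < 1") auto
  then have "m = 0" if "m \<in> Poly_Mapping.keys h" for m
    using that le_wdeg[of m h "\<lambda>m. Poly_Mapping.lookup m j" for j] by (intro poly_mapping_eqI) simp
  then have "Poly_Mapping.keys h = {}"
    using const by (metis all_not_in_conv in_keys_iff)
  then show ?thesis by simp
qed

section \<open>Total degree and homogeneity\<close>

definition tot :: "nat \<Rightarrow> (int \<Rightarrow>\<^sub>0 nat) \<Rightarrow> nat" where
  "tot n m = (\<Sum>j = 1..int n. Poly_Mapping.lookup m j)"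

lemma tot_add: "tot n (a + b) = tot n a + tot n b"
  by (simp add: tot_def lookup_add sum.distrib)

lemma tot_zero [simp]: "tot n 0 = 0"
  by (simp add: tot_def)

text \<open>Counting only the variables 1 to n keeps \<open>tot\<close> a sum over a fixed finite
  set, and the exchange permutes this set.\<close>

lemma tot_swap_mon:
  assumes "1 \<le> i" "i < int n"
  shows "tot n (swap_mon i m) = tot n m"
proof -
  have "adj i permutes {1..int n}"
    using assms by (intro permutes_swap_id) auto
  then show ?thesis
    unfolding tot_def lookup_swap_mon by (rule sum.permute[symmetric, unfolded comp_def])
qed

lemma tot_single: "1 \<le> i \<Longrightarrow> i \<le> int n \<Longrightarrow> tot n (Poly_Mapping.single i 1) = 1"
  by (simp add: tot_def lookup_single when_def)

lemma tot_X_diff: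
  assumes "1 \<le> i" "i < int n" "m \<in> Poly_Mapping.keys (X i - X (i + 1))"
  shows "tot n m = 1"
  using assms tot_single[of i n] tot_single[of "i + 1" n] by (auto simp: keys_X_diff)

text \<open>This drop drives the induction that expands staircase polynomials.\<close>

lemma wdeg_tot_divdiff:
  assumes i: "1 \<le> i" "i < int n" and nz: "divdiff i f \<noteq> 0"
  shows "wdeg (tot n) (divdiff i f) < wdeg (tot n) f"
proof -
  have "wdeg (tot n) (X i - X (i + 1)) = 1"
    using wdeg_attained[of "X i - X (i + 1)" "tot n"] tot_X_diff[OF i] by auto
  then have "1 + wdeg (tot n) (divdiff i f) = wdeg (tot n) (f - swap_vars i f)"
    using wdeg_mult[of "tot n" "X i - X (i + 1)" "divdiff i f"] nz by (simp add: tot_add divdiff_mult)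
  also have "\<dots> \<le> wdeg (tot n) f"
    using wdeg_diff_le[of "tot n" f "swap_vars i f"] by (simp add: wdeg_swap_vars tot_swap_mon[OF i])
  finally show ?thesis by simp
qed

lemma wpart_swap_vars:
  assumes "1 \<le> i" "i < int n"
  shows "wpart (tot n) d (swap_vars i f) = swap_vars i (wpart (tot n) d f)"
  by (rule poly_mapping_eqI) (simp add: lookup_wpart lookup_swap_vars tot_swap_mon[OF assms])

text \<open>Comparing the parts of one weight in the defining equation, a component of the quotient
  in any degree other than d - 1 is killed by X i - X (i + 1), hence zero.\<close>

lemma homogeneous_divdiff:
  assumes i: "1 \<le> i" "i < int n" and f: "\<And>m. m \<in> Poly_Mapping.keys f \<Longrightarrow> tot n m = d"
    and m: "m \<in> Poly_Mapping.keys (divdiff i f)"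
  shows "tot n m + 1 = d"
proof (rule ccontr)
  assume ne: "tot n m + 1 \<noteq> d"
  let ?p = "wpart (tot n) (1 + tot n m)"
  have "?p f = 0"
    unfolding keys_eq_empty[symmetric] keys_wpart using ne by (auto dest: f)
  have "(X i - X (i + 1)) * wpart (tot n) (tot n m) (divdiff i f) = ?p ((X i - X (i + 1)) * divdiff i f)"
    by (rule wpart_mult_homogeneous[symmetric]) (auto simp: tot_add tot_X_diff[OF i])
  also have "\<dots> = 0"
    using \<open>?p f = 0\<close> by (simp add: divdiff_mult wpart_diff wpart_swap_vars[OF i])
  finally have "wpart (tot n) (tot n m) (divdiff i f) = 0"
    by simp
  then show False
    using m keys_wpart[of "tot n" "tot n m" "divdiff i f"] by auto
qed

lemma schubert_homogeneous:
  assumes "w \<in> S_fin n"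
  shows "\<exists>d. \<forall>m\<in>Poly_Mapping.keys (schubert w). tot n m = d"
proof -
  have "\<exists>d. \<forall>m\<in>Poly_Mapping.keys (schubert_from n w). tot n m = d"
    using assms
  proof (induction w rule: S_fin_induct)
    case longest
    have "\<exists>a. top_monomial n = Poly_Mapping.single a 1"
    proof -
      have pow: "\<exists>a. X i ^ k = Poly_Mapping.single a 1" for i k
      proof (induction k)
        case 0
        then show ?case by (metis power_0 single_one)
      next
        case (Suc k)
        then obtain a where "X i ^ k = Poly_Mapping.single a 1" by blast
        then have "X i ^ Suc k = Poly_Mapping.single (Poly_Mapping.single i 1 + a) 1"
          by (simp add: X_def mult_single)
        then show ?case by blast
      qed
      have "\<exists>a. (\<Prod>i\<in>A. X (int i) ^ (n - i)) = Poly_Mapping.single a 1" for A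
      proof (induction A rule: infinite_finite_induct)
        case (insert x A)
        then obtain a where a: "(\<Prod>i\<in>A. X (int i) ^ (n - i)) = Poly_Mapping.single a 1" by blast
        obtain b where "X (int x) ^ (n - x) = Poly_Mapping.single b 1"
          using pow by blast
        then have "(\<Prod>i\<in>insert x A. X (int i) ^ (n - i)) = Poly_Mapping.single (b + a) 1"
          using insert a by (simp add: mult_single)
        then show ?case by blast
      qed (metis prod.infinite prod.empty single_one)+
      then show ?thesis by (simp add: top_monomial_def)
    qed
    then show ?case by (auto simp: schubert_from_longest)
  next
    case (descent w i)
    then obtain d where d: "\<And>m. m \<in> Poly_Mapping.keys (schubert_from n w) \<Longrightarrow> tot n m = d"
      by blast
    have "tot n m = d - 1" if "m \<in> Poly_Mapping.keys (divdiff i (schubert_from n w))" for m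
      using homogeneous_divdiff[OF descent.hyps(2,3) d that] by simp
    then show ?case
      using schubert_from_descent[OF descent.hyps(1,2,4)] by metis
  qed
  then show ?thesis
    using assms by (simp add: schubert_eq)
qed

text \<open>A constant term would force the homogeneous degree to be 0, but the divided difference
  at a descent is nonzero and one degree lower.\<close>

lemma schubert_constant_term:
  assumes w: "w \<in> S_pos" "w \<noteq> id"
  shows "Poly_Mapping.lookup (schubert w) 0 = 0"
proof (rule ccontr)
  assume "Poly_Mapping.lookup (schubert w) 0 \<noteq> 0"
  then have zero: "0 \<in> Poly_Mapping.keys (schubert w)"
    by (simp add: in_keys_iff)
  obtain n where n: "w \<in> S_fin n"
    using S_pos_imp_S_fin[OF w(1)] .
  have hom: "tot n m = 0" if "m \<in> Poly_Mapping.keys (schubert w)" for m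
    using schubert_homogeneous[OF n] zero that by (metis tot_zero)
  obtain i where i: "i \<ge> 1" "w i > w (i + 1)"
    using no_descent_imp_id w by blast
  then have "i < int n"
    using S_fin_descent n by blast
  have "schubert (w \<circ> adj i) \<noteq> 0"
    using schubert_nonzero S_pos_comp_adj w i by blast
  then obtain m where "m \<in> Poly_Mapping.keys (divdiff i (schubert w))"
    using divdiff_schubert_descent[OF w(1) i] by (metis keys_eq_empty ex_in_conv)
  then show False
    using homogeneous_divdiff[OF i(1) \<open>i < int n\<close>, of "schubert w" 0 m] hom by auto
qed

subsection \<open>Schubert expansions\<close>

text \<open>The words take values in operators, and each letter precomposes, so the divided
  difference at a descent of w acts on the polynomial before those of the remaining chain.\<close>

definition divdiff_perm :: "(int \<Rightarrow> int) \<Rightarrow> int_mpoly \<Rightarrow> int_mpoly" where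
  "divdiff_perm = braid_word (\<lambda>i g f. g (divdiff i f)) (\<lambda>f. f)"

text \<open>The coordinate functional of the Schubert basis belonging to w.\<close>

definition schubert_coeff :: "(int \<Rightarrow> int) \<Rightarrow> int_mpoly \<Rightarrow> int" where
  "schubert_coeff w f = Poly_Mapping.lookup (divdiff_perm w f) 0"

lemma schubert_coeff_id: "schubert_coeff id f = Poly_Mapping.lookup f 0"
  by (simp only: schubert_coeff_def divdiff_perm_def braid_word_id)

lemma schubert_coeff_descent:
  assumes "w \<in> S_pos" "i \<ge> 1" "w i > w (i + 1)"
  shows "schubert_coeff w f = schubert_coeff (w \<circ> adj i) (divdiff i f)"
proof -
  have "divdiff_perm w = (\<lambda>f. divdiff_perm (w \<circ> adj i) (divdiff i f))"
    unfolding divdiff_perm_def using assms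
    by (intro braid_word_descent) (simp_all add: divdiff_commute divdiff_braid)
  then show ?thesis
    by (simp only: schubert_coeff_def)
qed

lemma schubert_coeff_zero: "w \<in> S_pos \<Longrightarrow> schubert_coeff w 0 = 0"
proof (induction w rule: measure_induct_rule[of disp])
  case (less w)
  show ?case
  proof (cases "\<exists>i\<ge>1. w i > w (i + 1)")
    case False
    then have "w = id" using no_descent_imp_id less.prems by blast
    then show ?thesis using schubert_coeff_id[of 0] by (metis lookup_zero)
  next
    case True
    then obtain i where i: "i \<ge> 1" "w i > w (i + 1)" by blast
    then have "schubert_coeff (w \<circ> adj i) 0 = 0"
      using less disp_descent S_pos_comp_adj by blast
    then show ?thesis
      using schubert_coeff_descent[OF less.prems i, of 0] by simp
  qed
qed

lemma schubert_coeff_divdiff_descent: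
  assumes "w \<in> S_pos" "i \<ge> 1" "w i > w (i + 1)"
  shows "schubert_coeff w (divdiff i f) = 0"
  using schubert_coeff_descent[OF assms, of "divdiff i f"] schubert_coeff_zero S_pos_comp_adj assms
  by simp

text \<open>A discrete Taylor formula. The remainder h is annihilated by each divided difference, by
  induction applied to \<open>divdiff i f\<close>, and its constant term is 0 because only the
  identity contributes there; so h vanishes.\<close>

lemma schubert_expansion:
  "staircase n f \<Longrightarrow> f = (\<Sum>w\<in>S_fin n. of_int (schubert_coeff w f) * schubert w)"
proof (induction f rule: measure_induct_rule[of "wdeg (tot n)"])
  case (less f)
  define h where "h = f - (\<Sum>w\<in>S_fin n. of_int (schubert_coeff w f) * schubert w)"
  have h: "staircase n h"
    unfolding h_def
    by (intro staircase_diff staircase_sum staircase_of_int_mult staircase_schubert less.prems)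
  have "divdiff i h = 0" if i: "i \<ge> 1" for i
  proof (cases "i < int n")
    case False
    then show ?thesis using staircase_divdiff_zero[OF h] by simp
  next
    case True
    have IH: "divdiff i f = (\<Sum>w\<in>S_fin n. of_int (schubert_coeff w (divdiff i f)) * schubert w)"
    proof (cases "divdiff i f = 0")
      case True
      then show ?thesis by (simp add: schubert_coeff_zero S_fin_in_S_pos)
    next
      case False
      then show ?thesis
        using less.IH[OF wdeg_tot_divdiff[OF i True False] staircase_divdiff[OF less.prems i]] by simp
    qed
    have bij: "bij_betw (\<lambda>w. w \<circ> adj i) (S_fin n) (S_fin n)"
      by (rule bij_betwI[where g = "\<lambda>w. w \<circ> adj i"])
        (use i True in \<open>auto intro!: S_fin_comp adj_in_S_fin simp only: adj_comp_adj\<close>)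
    have "divdiff i (\<Sum>w\<in>S_fin n. of_int (schubert_coeff w f) * schubert w)
      = (\<Sum>w\<in>S_fin n. of_int (schubert_coeff w f) * divdiff i (schubert w))"
      by (simp add: divdiff_sum divdiff_of_int_mult)
    \<comment> \<open>Reindexing by the exchange aligns this with the expansion of
      \<open>divdiff i f\<close>: at an ascent of w the terms agree, at a descent both are
      0.\<close>
    also have "\<dots> = (\<Sum>w\<in>S_fin n. of_int (schubert_coeff (w \<circ> adj i) f) * divdiff i (schubert (w \<circ> adj i)))"
      by (rule sum.reindex_bij_betw[OF bij, symmetric])
    also have "\<dots> = (\<Sum>w\<in>S_fin n. of_int (schubert_coeff w (divdiff i f)) * schubert w)"
    proof (rule sum.cong)
      fix w assume "w \<in> S_fin n"
      then have w: "w \<in> S_pos" "w \<circ> adj i \<in> S_pos"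
        using S_fin_in_S_pos S_pos_comp_adj i by blast+
      consider "w i < w (i + 1)" | "w i > w (i + 1)"
        using S_pos_inj[OF w(1), of i "i + 1"] by linarith
      then show "of_int (schubert_coeff (w \<circ> adj i) f) * divdiff i (schubert (w \<circ> adj i)) =
          of_int (schubert_coeff w (divdiff i f)) * schubert w"
      proof cases
        case 1
        then have "(w \<circ> adj i) i > (w \<circ> adj i) (i + 1)"
          by simp
        then have "schubert_coeff (w \<circ> adj i) f = schubert_coeff (w \<circ> adj i \<circ> adj i) (divdiff i f)"
          "divdiff i (schubert (w \<circ> adj i)) = schubert (w \<circ> adj i \<circ> adj i)"
          using schubert_coeff_descent[OF w(2) i] divdiff_schubert_descent[OF w(2) i] by blast+
        then show ?thesis by (simp only: adj_comp_adj)
      next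
        case 2
        then have "divdiff i (schubert (w \<circ> adj i)) = 0"
          using i w(2) by (intro divdiff_schubert_ascent) auto
        moreover have "schubert_coeff w (divdiff i f) = 0"
          using schubert_coeff_divdiff_descent[OF w(1) i 2] .
        ultimately show ?thesis by (metis mult_zero_left mult_zero_right of_int_0)
      qed
    qed simp
    also have "\<dots> = divdiff i f"
      using IH by simp
    finally show ?thesis
      by (simp add: h_def divdiff_diff)
  qed
  moreover have "Poly_Mapping.lookup h 0 = 0"
  proof -
    have "Poly_Mapping.lookup (of_int c * p) 0 = c * Poly_Mapping.lookup p 0" for c and p :: int_mpoly
      by (simp add: map.rep_eq when_def flip: single_of_int mult_map_scale_conv_mult)
    then have "Poly_Mapping.lookup (\<Sum>w\<in>S_fin n. of_int (schubert_coeff w f) * schubert w) 0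
      = (\<Sum>w\<in>S_fin n. schubert_coeff w f * Poly_Mapping.lookup (schubert w) 0)"
      by (simp add: lookup_sum)
    also have "\<dots> = (\<Sum>w\<in>{id}. schubert_coeff w f * Poly_Mapping.lookup (schubert w) 0)"
      by (rule sum.mono_neutral_right)
        (auto simp: finite_S_fin id_in_S_fin schubert_constant_term S_fin_in_S_pos)
    also have "\<dots> = Poly_Mapping.lookup f 0"
      by (simp add: schubert_coeff_id)
    finally show ?thesis
      by (simp add: h_def lookup_minus)
  qed
  ultimately have "h = 0"
    by (rule staircase_invariant_eq_zero[OF h])
  then show ?case
    by (simp add: h_def)
qed

text \<open>\<open>divdiff i\<close> kills the terms with an ascent at i and sends the others to
  distinct permutations of smaller \<open>disp\<close>. By induction every coefficient at a
  permutation with a descent vanishes, which leaves only the identity.\<close>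

lemma schubert_independent:
  assumes "finite A" "A \<subseteq> S_pos" "(\<Sum>w\<in>A. of_int (c w) * schubert w) = 0" "w \<in> A"
  shows "c w = 0"
proof -
  have "\<forall>w\<in>A. disp w < Suc (Max (disp ` A))"
    using assms(1) by (simp add: less_Suc_eq_le)
  then obtain N where "\<forall>w\<in>A. disp w < N" ..
  then show ?thesis
    using assms
  proof (induction N arbitrary: A c w)
    case (Suc N)
    have desc: "c w = 0" if w: "w \<in> A" and i: "i \<ge> 1" "w i > w (i + 1)" for w i
    proof -
      let ?A = "{w \<in> A. w i > w (i + 1)}" and ?f = "\<lambda>w. w \<circ> adj i"
      have inj: "inj_on ?f ?A"
        by (rule inj_onI) (metis adj_comp_adj)
      have "0 = divdiff i (\<Sum>w\<in>A. of_int (c w) * schubert w)"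
        using Suc.prems by simp
      also have "\<dots> = (\<Sum>w\<in>A. of_int (c w) * divdiff i (schubert w))"
        by (simp add: divdiff_sum divdiff_of_int_mult)
      also have "\<dots> = (\<Sum>w\<in>?A. of_int (c w) * divdiff i (schubert w))"
      proof (rule sum.mono_neutral_right)
        show "\<forall>w\<in>A - ?A. of_int (c w) * divdiff i (schubert w) = 0"
        proof
          fix w assume "w \<in> A - ?A"
          then have "w \<in> S_pos" "w i < w (i + 1)"
            using Suc.prems S_pos_inj[of w i "i + 1"] by (auto simp: not_less le_less)
          then show "of_int (c w) * divdiff i (schubert w) = 0"
            using divdiff_schubert_ascent i by simp
        qed
      qed (use Suc.prems in auto)
      \<comment> \<open>Writing w with a double exchange makes the coefficient a function of the
        image under \<open>?f\<close>.\<close>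
      also have "\<dots> = (\<Sum>w\<in>?A. of_int (c (w \<circ> adj i \<circ> adj i)) * schubert (w \<circ> adj i))"
        using Suc.prems i by (intro sum.cong) (auto simp only: adj_comp_adj mem_Collect_eq divdiff_schubert_descent subset_eq)
      also have "\<dots> = (\<Sum>v\<in>?f ` ?A. of_int (c (v \<circ> adj i)) * schubert v)"
        by (simp only: sum.reindex[OF inj] comp_def[of _ ?f])
      finally have 0: "(\<Sum>v\<in>?f ` ?A. of_int (c (v \<circ> adj i)) * schubert v) = 0" ..
      have 1: "\<forall>v\<in>?f ` ?A. disp v < N"
      proof
        fix v assume "v \<in> ?f ` ?A"
        then obtain w where "w \<in> A" "w i > w (i + 1)" "v = w \<circ> adj i" by blast
        then show "disp v < N"
          using disp_descent[of w i] Suc.prems by fastforce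
      qed
      have 2: "?f ` ?A \<subseteq> S_pos"
        using Suc.prems i S_pos_comp_adj by blast
      have "c (w \<circ> adj i \<circ> adj i) = 0"
      proof (rule Suc.IH[where c = "\<lambda>v. c (v \<circ> adj i)", OF 1 _ 2 0])
        show "w \<circ> adj i \<in> ?f ` ?A"
          using w i by blast
      qed (use Suc.prems in simp)
      then show ?thesis by (metis adj_comp_adj)
    qed
    have other: "c v = 0" if "v \<in> A" "v \<noteq> id" for v
    proof -
      have "v \<in> S_pos" using that Suc.prems by blast
      then obtain i where "i \<ge> 1" "v i > v (i + 1)"
        using no_descent_imp_id[of v] \<open>v \<noteq> id\<close> by meson
      then show ?thesis using desc[of v i] that by simp
    qed
    show ?case
    proof (cases "w = id")
      case True
      have "(\<Sum>w\<in>A. of_int (c w) * schubert w) = (\<Sum>w\<in>{id}. of_int (c w) * schubert w)"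
      proof (rule sum.mono_neutral_right)
        show "{id} \<subseteq> A"
          using Suc.prems(5) True by blast
      qed (use Suc.prems other in auto)
      then have "(of_int (c id) :: int_mpoly) = 0"
        using Suc.prems by simp
      then have "c id = 0"
        by simp
      then show ?thesis
        using True by metis
    qed (use other Suc.prems in blast)
  qed simp
qed

lemma schubert_const_unique:
  assumes "finite {w. c w \<noteq> 0}" "{w. c w \<noteq> 0} \<subseteq> S_pos"
    "finite {w. c' w \<noteq> 0}" "{w. c' w \<noteq> 0} \<subseteq> S_pos"
    "(\<Sum>w | c w \<noteq> 0. of_int (c w) * schubert w) = (\<Sum>w | c' w \<noteq> 0. of_int (c' w) * schubert w)"
  shows "c = c'"
proof
  fix w
  let ?A = "{w. c w \<noteq> 0} \<union> {w. c' w \<noteq> 0}"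
  have "(\<Sum>w | c w \<noteq> 0. of_int (c w) * schubert w) = (\<Sum>w\<in>?A. of_int (c w) * schubert w)"
    "(\<Sum>w | c' w \<noteq> 0. of_int (c' w) * schubert w) = (\<Sum>w\<in>?A. of_int (c' w) * schubert w)"
    by (rule sum.mono_neutral_left; use assms(1,3) in auto)+
  then have "(\<Sum>w\<in>?A. of_int (c w - c' w) * schubert w) = 0"
    using assms(5) by (simp add: left_diff_distrib sum_subtractf)
  then have "w \<in> ?A \<Longrightarrow> c w - c' w = 0"
    using assms by (intro schubert_independent[of ?A "\<lambda>w. c w - c' w"]) auto
  then show "c w = c' w" by (cases "w \<in> ?A") auto
qed

text \<open>The expansion of a staircase polynomial uses only S_n, and by uniqueness it is the one
  described by \<open>schubert_const\<close>.\<close>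

lemma schubert_const_unfold:
  assumes "staircase n (schubert u * schubert v)"
  shows "{w. schubert_const u v w \<noteq> 0} \<subseteq> S_fin n"
    and "schubert u * schubert v =
      (\<Sum>w | schubert_const u v w \<noteq> 0. of_int (schubert_const u v w) * schubert w)"
proof -
  let ?f = "schubert u * schubert v"
  define c where "c w = (if w \<in> S_fin n then schubert_coeff w ?f else 0)" for w
  have fin: "finite {w. c w \<noteq> 0}" and sub: "{w. c w \<noteq> 0} \<subseteq> S_fin n"
    using finite_S_fin[of n] by (auto simp: c_def intro: finite_subset)
  have pos: "{w. c w \<noteq> 0} \<subseteq> S_pos"
    using sub S_fin_in_S_pos by blast
  have "?f = (\<Sum>w\<in>S_fin n. of_int (c w) * schubert w)"
    using schubert_expansion[OF assms] by (simp add: c_def)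
  also have "\<dots> = (\<Sum>w | c w \<noteq> 0. of_int (c w) * schubert w)"
    using sub by (intro sum.mono_neutral_right) (auto simp: finite_S_fin)
  finally have f: "?f = (\<Sum>w | c w \<noteq> 0. of_int (c w) * schubert w)" .
  have "schubert_const u v = c"
    unfolding schubert_const_def
  proof (rule the_equality)
    fix c' assume c': "finite {w. c' w \<noteq> 0} \<and> {w. c' w \<noteq> 0} \<subseteq> S_pos \<and>
      ?f = (\<Sum>w | c' w \<noteq> 0. of_int (c' w) * schubert w)"
    then show "c' = c"
      using fin pos f by (intro schubert_const_unique) auto
  qed (use fin pos f in blast)
  then show "{w. schubert_const u v w \<noteq> 0} \<subseteq> S_fin n"
    and "?f = (\<Sum>w | schubert_const u v w \<noteq> 0. of_int (schubert_const u v w) * schubert w)"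
    using sub f by simp_all
qed

section \<open>FS of a product read off from the staircase condition\<close>

lemma FS_le_iff:
  assumes "w \<in> S_pos" "n \<ge> 1"
  shows "FS w \<le> n \<longleftrightarrow> w \<in> S_fin n"
proof
  obtain k where "k \<ge> 1" "w \<in> S_fin k"
    using S_pos_imp_S_fin[OF assms(1)] .
  then have "FS w \<ge> 1 \<and> w \<in> S_fin (FS w)"
    unfolding FS_def by (intro LeastI_ex[of "\<lambda>n. n \<ge> 1 \<and> w \<in> S_fin n"]) blast
  then show "FS w \<le> n \<Longrightarrow> w \<in> S_fin n"
    using S_fin_mono by blast
  show "w \<in> S_fin n \<Longrightarrow> FS w \<le> n"
    unfolding FS_def using assms by (intro Least_le) simp
qed

lemma FS_ge_1: "w \<in> S_pos \<Longrightarrow> FS w \<ge> 1"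
  by (rule S_pos_imp_S_fin[of w], assumption) (auto simp: FS_def intro: LeastI2)

text \<open>A crude bound, used to place a product in some staircase so that its structure constants
  become available.\<close>

lemma staircase_mult:
  assumes "staircase n f" "staircase m g"
  shows "staircase (n + m) (f * g)"
  unfolding staircase_def
proof
  fix j
  show "vdeg j (f * g) \<le> (if j < 1 then 0 else nat (int (n + m) - j))"
    using vdeg_mult_le[of j f g] staircaseD[OF assms(1), of j] staircaseD[OF assms(2), of j]
      staircase_nonpos[OF assms(1), of j] staircase_nonpos[OF assms(2), of j] by auto
qed

text \<open>One direction adds up staircase polynomials, the other is the support bound from the
  expansion. \<open>Max\<close> is meaningful because the support is finite, and nonempty as the
  product is nonzero.\<close>

lemma FS_prod_le_iff:
  assumes u: "u \<in> S_pos" and v: "v \<in> S_pos"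
  shows "FS_prod u v \<ge> 1"
    and "n \<ge> 1 \<Longrightarrow> FS_prod u v \<le> n \<longleftrightarrow> staircase n (schubert u * schubert v)"
proof -
  let ?f = "schubert u * schubert v" and ?c = "schubert_const u v"
  obtain a b where "u \<in> S_fin a" "v \<in> S_fin b"
    using S_pos_imp_S_fin u v by metis
  then have st: "staircase (a + b) ?f"
    by (intro staircase_mult staircase_schubert)
  let ?W = "{w. ?c w \<noteq> 0}"
  have pos: "?W \<subseteq> S_pos"
    using schubert_const_unfold(1)[OF st] S_fin_in_S_pos by blast
  have fin: "finite ?W"
    using schubert_const_unfold(1)[OF st] finite_S_fin finite_subset by blast
  have exp: "?f = (\<Sum>w | ?c w \<noteq> 0. of_int (?c w) * schubert w)"
    by (rule schubert_const_unfold(2)[OF st])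
  have "?f \<noteq> 0"
    using u v schubert_nonzero by simp
  then have ne: "?W \<noteq> {}"
    using exp by (metis sum.empty)
  have "{FS w | w. w \<in> S_pos \<and> ?c w \<noteq> 0} = FS ` ?W"
    using pos by blast
  then have Max: "FS_prod u v = Max (FS ` ?W)"
    by (simp add: FS_prod_def)
  obtain w where w: "w \<in> ?W"
    using ne by blast
  then have "1 \<le> FS w"
    using pos FS_ge_1 by blast
  also have "\<dots> \<le> FS_prod u v"
    unfolding Max using fin w by (intro Max_ge) auto
  finally show "FS_prod u v \<ge> 1" .
  assume n: "n \<ge> 1"
  have "FS_prod u v \<le> n \<longleftrightarrow> (\<forall>w\<in>?W. FS w \<le> n)"
    unfolding Max using fin ne by (simp add: Max_le_iff)
  also have "\<dots> \<longleftrightarrow> ?W \<subseteq> S_fin n"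
    using FS_le_iff n pos by blast
  also have "\<dots> \<longleftrightarrow> staircase n ?f"
  proof
    assume "?W \<subseteq> S_fin n"
    then show "staircase n ?f"
      by (subst exp) (auto intro!: staircase_sum staircase_of_int_mult staircase_schubert)
  qed (rule schubert_const_unfold(1))
  finally show "FS_prod u v \<le> n \<longleftrightarrow> staircase n ?f" .
qed

subsection \<open>Degrees of Schubert polynomials\<close>

text \<open>The positions that are not left-to-right maxima of the word w k, w (k + 1), ....\<close>

definition local_nonrecords :: "int \<Rightarrow> (int \<Rightarrow> int) \<Rightarrow> int set" where
  "local_nonrecords k w = {j. j > k \<and> (\<exists>j'. k \<le> j' \<and> j' < j \<and> w j' > w j)}"

lemma S_fin_inversion:
  assumes "w \<in> S_fin n" "i < j" "w i > w j"
  shows "1 \<le> i" "j \<le> int n"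
proof -
  note w = S_fin_in_S_pos[OF assms(1)]
  show "1 \<le> i"
  proof (rule ccontr)
    assume "\<not> 1 \<le> i"
    then show False
      using assms S_pos_nonpos[OF w, of i] S_pos_nonpos[OF w, of j] S_pos_ge_1[OF w, of j] by linarith
  qed
  show "j \<le> int n"
  proof (rule ccontr)
    assume j: "\<not> j \<le> int n"
    then have "w j = j"
      using assms by (simp add: S_fin_def)
    moreover have "w i = i \<or> w i \<le> int n"
      using assms S_fin_le[OF assms(1), of i] by (cases "i \<le> int n") (auto simp: S_fin_def)
    ultimately show False
      using assms j by linarith
  qed
qed

lemma finite_local_nonrecords:
  assumes "w \<in> S_pos"
  shows "finite (local_nonrecords k w)"
proof -
  obtain n where "w \<in> S_fin n"
    using S_pos_imp_S_fin[OF assms] .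
  then have "local_nonrecords k w \<subseteq> {k..int n}"
    using S_fin_inversion(2) by (force simp: local_nonrecords_def)
  then show ?thesis
    using finite_subset by blast
qed

lemma local_nonrecords_empty:
  assumes "w \<in> S_fin n" "k \<ge> int n"
  shows "local_nonrecords k w = {}"
  using S_fin_inversion(2)[OF assms(1)] assms(2) by (force simp: local_nonrecords_def)

text \<open>The larger value at k + 1 replaces k as a witness, and k + 1 itself is a record of the
  word starting at k.\<close>

lemma local_nonrecords_ascent:
  assumes "w k < w (k + 1)"
  shows "local_nonrecords k w = local_nonrecords (k + 1) w"
proof -
  have "j \<in> local_nonrecords k w \<longleftrightarrow> j \<in> local_nonrecords (k + 1) w" for j
  proof
    assume "j \<in> local_nonrecords k w"
    then obtain i where i: "k \<le> i" "i < j" "w i > w j"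
      by (auto simp: local_nonrecords_def)
    show "j \<in> local_nonrecords (k + 1) w"
    proof (cases "i = k")
      case True
      then have "j \<noteq> k + 1" using assms i by auto
      then have "k + 1 < j" "w (k + 1) > w j" using True assms i by auto
      then show ?thesis by (auto simp: local_nonrecords_def)
    next
      case False
      then have "k + 1 < j \<and> k + 1 \<le> i \<and> i < j \<and> w i > w j" using i by auto
      then show ?thesis unfolding local_nonrecords_def mem_Collect_eq by metis
    qed
  next
    assume "j \<in> local_nonrecords (k + 1) w"
    then obtain i where "k + 1 \<le> i" "i < j" "w i > w j"
      by (auto simp: local_nonrecords_def)
    then have "k \<le> i" "i < j" "w i > w j" "k < j" by auto
    then show "j \<in> local_nonrecords k w"
      unfolding local_nonrecords_def by blast
  qed
  then show ?thesis by blast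
qed

text \<open>Exchanging k and k + 1 leaves the set of values in front of any later position
  unchanged; only the status of k + 1 changes.\<close>

lemma local_nonrecords_descent:
  assumes "w k > w (k + 1)"
  shows "local_nonrecords k w = insert (k + 1) (local_nonrecords k (w \<circ> adj k))"
    and "k + 1 \<notin> local_nonrecords k (w \<circ> adj k)"
    and "local_nonrecords (k + 1) w \<subseteq> local_nonrecords k (w \<circ> adj k)"
proof -
  have far: "j \<in> local_nonrecords k (w \<circ> adj k) \<longleftrightarrow> j \<in> local_nonrecords k w" if "j > k + 1" for j
  proof -
    have "(\<exists>i. k \<le> i \<and> i < j \<and> w (adj k i) > w j) \<longleftrightarrow> (\<exists>i. k \<le> i \<and> i < j \<and> w i > w j)"
    proof -
      have "k \<le> adj k i \<and> adj k i < j \<longleftrightarrow> k \<le> i \<and> i < j" for i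
        using that by (auto simp: transpose_def)
      then show ?thesis by (metis transpose_involutory)
    qed
    then show ?thesis
      using that by (simp add: local_nonrecords_def)
  qed
  have near: "k + 1 \<in> local_nonrecords k w"
    using assms by (auto simp: local_nonrecords_def)
  show notin: "k + 1 \<notin> local_nonrecords k (w \<circ> adj k)"
  proof
    assume "k + 1 \<in> local_nonrecords k (w \<circ> adj k)"
    then obtain i where "k \<le> i" "i < k + 1" "w (adj k i) > w k"
      by (auto simp: local_nonrecords_def)
    moreover from this have "i = k" by simp
    ultimately show False using assms by simp
  qed
  have gt: "j \<in> local_nonrecords k x \<Longrightarrow> j = k + 1 \<or> j > k + 1" for j x
    by (auto simp: local_nonrecords_def)
  show "local_nonrecords k w = insert (k + 1) (local_nonrecords k (w \<circ> adj k))"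
  proof (rule set_eqI)
    fix j
    consider "j = k + 1" | "j > k + 1" | "j < k + 1" by linarith
    then show "j \<in> local_nonrecords k w \<longleftrightarrow> j \<in> insert (k + 1) (local_nonrecords k (w \<circ> adj k))"
      using near far[of j] gt[of j w] gt[of j "w \<circ> adj k"] by cases auto
  qed
  show "local_nonrecords (k + 1) w \<subseteq> local_nonrecords k (w \<circ> adj k)"
  proof
    fix j assume "j \<in> local_nonrecords (k + 1) w"
    then obtain i where "k + 1 \<le> i" "i < j" "w i > w j"
      by (auto simp: local_nonrecords_def)
    then have j: "j > k + 1" and "k < j \<and> k \<le> i \<and> i < j \<and> w i > w j" by auto
    then have "j \<in> local_nonrecords k w"
      unfolding local_nonrecords_def mem_Collect_eq by metis
    then show "j \<in> local_nonrecords k (w \<circ> adj k)"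
      using far[OF j] by simp
  qed
qed

text \<open>The outer induction on \<open>disp\<close> supplies w with k and k + 1 exchanged; the
  inner one, downwards in k from n, supplies the same w at k + 1. Degree and count agree at ascents
  because both pass unchanged from k + 1 to k, and at descents because both exceed those of the
  exchanged permutation by 1.\<close>

lemma vdeg_schubert:
  "w \<in> S_pos \<Longrightarrow> k \<ge> 1 \<Longrightarrow> vdeg k (schubert w) = card (local_nonrecords k w)"
proof (induction w arbitrary: k rule: measure_induct_rule[of disp])
  case (less w)
  note w = less.prems(1)
  obtain n where n: "w \<in> S_fin n"
    using S_pos_imp_S_fin[OF w] .
  show ?case
    using less.prems(2)
  proof (induction "nat (int n - k)" arbitrary: k)
    case 0
    then have "vdeg k (schubert w) = 0"
      using staircaseD[OF staircase_schubert[OF n], of k] by simp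
    moreover have "local_nonrecords k w = {}"
      using local_nonrecords_empty[OF n] 0 by simp
    ultimately show ?case by (metis card.empty)
  next
    case (Suc d)
    have next_k: "vdeg (k + 1) (schubert w) = card (local_nonrecords (k + 1) w)"
      using Suc.hyps(1)[of "k + 1"] Suc.hyps(2) Suc.prems by simp
    consider "w k < w (k + 1)" | "w k > w (k + 1)"
      using S_pos_inj[OF w, of k "k + 1"] by linarith
    then show ?case
    proof cases
      case 1
      then have "swap_vars k (schubert w) = schubert w"
        using divdiff_schubert_ascent[OF w Suc.prems] divdiff_eq_zero_iff by blast
      then have "vdeg k (schubert w) = vdeg (k + 1) (schubert w)"
        using vdeg_swap_vars[of k k "schubert w"] by simp
      then show ?thesis
        using next_k local_nonrecords_ascent[OF 1] by metis
    next
      case 2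
      let ?g = "schubert (w \<circ> adj k)" and ?p = "schubert w"
      have w': "w \<circ> adj k \<in> S_pos"
        using w Suc.prems by (rule S_pos_comp_adj)
      have g: "vdeg k ?g = card (local_nonrecords k (w \<circ> adj k))"
        using less.IH[OF disp_descent[OF w 2] w' Suc.prems] .
      have card_eq: "card (local_nonrecords k w) = Suc (vdeg k ?g)"
        unfolding g local_nonrecords_descent(1)[of w k, OF 2]
        using finite_local_nonrecords[OF w'] local_nonrecords_descent(2)[of w k, OF 2] by simp
      have next_le: "vdeg (k + 1) ?p \<le> vdeg k ?g"
        unfolding next_k g
        by (intro card_mono finite_local_nonrecords w' local_nonrecords_descent(3)[of w k, OF 2])
      have "(X k - X (k + 1)) * ?g = ?p - swap_vars k ?p"
        using divdiff_mult[of k ?p] divdiff_schubert_descent[OF w Suc.prems 2] by simp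
      then have p: "?p = (X k - X (k + 1)) * ?g + swap_vars k ?p"
        by simp
      have top: "vdeg k ((X k - X (k + 1)) * ?g) = Suc (vdeg k ?g)"
        using schubert_nonzero[OF w'] by (subst vdeg_mult) (simp_all add: vdeg_X_diff)
      \<comment> \<open>By \<open>next_le\<close> this is smaller than the degree of the other
        summand, so no cancellation can occur in the top degree.\<close>
      have "vdeg k (swap_vars k ?p) = vdeg (k + 1) ?p"
        by (simp add: vdeg_swap_vars)
      then have "vdeg k ((X k - X (k + 1)) * ?g + swap_vars k ?p) = Suc (vdeg k ?g)"
        using next_le top by (subst wdeg_add_eq) auto
      then show ?thesis
        using p card_eq by metis
    qed
  qed
qed

subsection \<open>The maximum formula\<close>

lemma finite_nonrecords:
  assumes "w \<in> S_pos"
  shows "finite {j. \<exists>j'<j. w j' > w j}"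
proof -
  obtain n where n: "w \<in> S_fin n"
    using S_pos_imp_S_fin[OF assms] .
  have "{j. \<exists>j'<j. w j' > w j} \<subseteq> {1..int n}"
    using S_fin_inversion[OF n] by force
  then show ?thesis
    using finite_subset by blast
qed

lemma card_local_nonrecords_le_Lam:
  assumes "w \<in> S_pos"
  shows "card (local_nonrecords k w) \<le> Lam (k + 1) w"
  unfolding Lam_def local_nonrecords_def using finite_nonrecords[OF assms]
  by (intro card_mono) (auto intro: finite_subset[rotated])

text \<open>A witness in front of k can be replaced by k, whose value is at least as large.\<close>

lemma Lam_record:
  assumes rec: "\<not> (\<exists>j<k. w j > w k)"
  shows "Lam (k + 1) w = card (local_nonrecords k w)"
proof -
  have "{j. j \<ge> k + 1 \<and> (\<exists>j'<j. w j' > w j)} = local_nonrecords k w"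
  proof -
    have "\<exists>i. k \<le> i \<and> i < j \<and> w i > w j" if "j > k" "i < j" "w i > w j" for i j
      using that rec by (cases "k \<le> i") (meson, metis less_le_trans linorder_not_le order_refl)
    then show ?thesis
      by (auto simp: local_nonrecords_def)
  qed
  then show ?thesis by (simp add: Lam_def)
qed

lemma Lam_split:
  assumes "w \<in> S_pos"
  shows "Lam k w = Lam (k + 1) w + (if \<exists>j<k. w j > w k then 1 else 0)"
proof -
  let ?A = "{j. j \<ge> k + 1 \<and> (\<exists>j'<j. w j' > w j)}"
  have "{j. j \<ge> k \<and> (\<exists>j'<j. w j' > w j)} = (if \<exists>j<k. w j > w k then insert k ?A else ?A)"
    by (auto simp: le_less)
  moreover have "finite ?A"
    using finite_nonrecords[OF assms] by (rule finite_subset[rotated]) auto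
  ultimately show ?thesis
    by (simp add: Lam_def)
qed

text \<open>Inversions take place among positive positions, so the later one is at least 2. Hence
  indices below 2 cannot beat i = 2 in the maximum.\<close>

lemma Lam_nonpos:
  assumes "w \<in> S_pos" "i \<le> 2"
  shows "Lam i w = Lam 2 w"
proof -
  obtain n where n: "w \<in> S_fin n"
    using S_pos_imp_S_fin[OF assms(1)] .
  have "j \<ge> 2" if "j' < j" "w j' > w j" for j j'
    using S_fin_inversion(1)[OF n that] that by simp
  then have "{j. j \<ge> i \<and> (\<exists>j'<j. w j' > w j)} = {j. j \<ge> 2 \<and> (\<exists>j'<j. w j' > w j)}"
    using assms(2) by force
  then show ?thesis by (simp add: Lam_def)
qed

text \<open>If m = FS w exceeded n, the value m would stand at some i < m, and the m - i positions i
  + 1, ..., m would all be nonrecords, more than n - i permits.\<close>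

lemma FS_le_of_local_nonrecords:
  assumes w: "w \<in> S_pos" and n: "n \<ge> 1"
    and le: "\<And>j. j \<ge> 1 \<Longrightarrow> card (local_nonrecords j w) \<le> nat (int n - j)"
  shows "FS w \<le> n"
proof (rule ccontr)
  assume gt: "\<not> FS w \<le> n"
  define m where "m = FS w"
  have m: "m > n" "w \<in> S_fin m" "w \<notin> S_fin (m - 1)"
  proof -
    show "m > n"
      using gt by (simp add: m_def)
    then show "w \<in> S_fin m" "w \<notin> S_fin (m - 1)"
      using n FS_le_iff[OF w, of m] FS_le_iff[OF w, of "m - 1"] unfolding m_def by linarith+
  qed
  \<comment> \<open>Minimality of m: otherwise w would already lie in S_(m-1).\<close>
  have "w (int m) \<noteq> int m"
  proof
    assume *: "w (int m) = int m"
    have "w j = j" if "j > int (m - 1)" for j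
      using that * m(1,2) by (cases "j = int m") (auto simp: S_fin_def)
    then show False
      using m(3) w by (simp add: S_fin_def)
  qed
  obtain i where i: "w i = int m"
  proof -
    have "surj w"
      using w permutes_surj by (auto simp: S_pos_def)
    then show thesis
      using surjD[of w "int m"] that by auto
  qed
  have "i \<ge> 1"
    using S_pos_ge_1[OF w, of i] i m(1) by simp
  have "i < int m"
  proof -
    have "i \<noteq> int m" using i \<open>w (int m) \<noteq> int m\<close> by blast
    moreover have "\<not> i > int m" using i m(2) by (auto simp: S_fin_def)
    ultimately show ?thesis by simp
  qed
  have "{i + 1..int m} \<subseteq> local_nonrecords i w"
  proof
    fix j assume j: "j \<in> {i + 1..int m}"
    have "w j \<le> int m"
      using S_fin_le[OF m(2)] j by simp
    moreover have "w j \<noteq> w i"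
      using S_pos_inj[OF w, of j i] j by auto
    ultimately show "j \<in> local_nonrecords i w"
      using i j by (auto simp: local_nonrecords_def)
  qed
  then have "card {i + 1..int m} \<le> card (local_nonrecords i w)"
    by (intro card_mono finite_local_nonrecords w)
  then show False
    using le[OF \<open>i \<ge> 1\<close>] \<open>i < int m\<close> m(1) by simp
qed

lemma staircase_product_iff:
  assumes u: "u \<in> S_pos" and v: "v \<in> S_pos"
  shows "staircase n (schubert u * schubert v) \<longleftrightarrow>
    (\<forall>j\<ge>1. card (local_nonrecords j u) + card (local_nonrecords j v) \<le> nat (int n - j))"
proof -
  obtain a b where "u \<in> S_fin a" "v \<in> S_fin b"
    using S_pos_imp_S_fin u v by metis
  then have "vdeg j (schubert u * schubert v) = 0" if "j < 1" for j
    using staircase_nonpos[OF _ that] staircase_mult staircase_schubert by blast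
  moreover have "vdeg j (schubert u * schubert v) =
      card (local_nonrecords j u) + card (local_nonrecords j v)" if "j \<ge> 1" for j
    using u v that by (simp add: vdeg_mult schubert_nonzero vdeg_schubert)
  ultimately show ?thesis
    by (auto simp: staircase_def not_less)
qed

text \<open>The indices correspond by i = j + 1. Towards the local counts it suffices that they are
  at most \<open>Lam\<close>; towards \<open>Lam\<close>, equality at common records is combined
  with monotonicity between them.\<close>

lemma Lam_sum_le_iff:
  fixes u v :: "int \<Rightarrow> int"
  defines "N \<equiv> int (max (FS u) (FS v))"
  assumes u: "u \<in> S_pos" and v: "v \<in> S_pos" and n: "n \<ge> 1"
  shows "(\<forall>i \<le> 1 + N. int (Lam i u) + int (Lam i v) + i - 1 \<le> int n) \<longleftrightarrow>
    (\<forall>j\<ge>1. card (local_nonrecords j u) + card (local_nonrecords j v) \<le> nat (int n - j))"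
    (is "(\<forall>i\<le>1 + N. ?F i \<le> int n) \<longleftrightarrow> ?R")
proof
  assume L: "\<forall>i \<le> 1 + N. ?F i \<le> int n"
  have FS: "u \<in> S_fin (FS u)" "v \<in> S_fin (FS v)"
    using u v FS_le_iff FS_ge_1 by auto
  show ?R
  proof (intro allI impI)
    fix j :: int assume "j \<ge> 1"
    show "card (local_nonrecords j u) + card (local_nonrecords j v) \<le> nat (int n - j)"
    proof (cases "j \<le> N")
      case True
      then have "?F (j + 1) \<le> int n"
        using L[rule_format, of "j + 1"] by simp
      then show ?thesis
        using card_local_nonrecords_le_Lam[OF u, of j] card_local_nonrecords_le_Lam[OF v, of j]
        by linarith
    next
      case False
      then have "local_nonrecords j u = {}" "local_nonrecords j v = {}"
        using FS by (auto intro!: local_nonrecords_empty simp: N_def)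
      then show ?thesis by simp
    qed
  qed
next
  assume R: ?R
  \<comment> \<open>Each count alone obeys the bound. The resulting N \<le> n ensures that
    \<open>nat (int n - j)\<close> is not truncated for j \<le> N.\<close>
  have "FS u \<le> n" "FS v \<le> n"
    using u v n R by (auto intro!: FS_le_of_local_nonrecords intro: order_trans[OF le_add1] order_trans[OF le_add2])
  then have N: "N \<le> int n"
    by (simp add: N_def)
  have both_records: "?F (i + 1) \<le> int n" if i: "1 \<le> i" "i \<le> N"
    and rec: "\<not> (\<exists>j<i. u j > u i)" "\<not> (\<exists>j<i. v j > v i)" for i
    using R[rule_format, OF i(1)] i N Lam_record[OF rec(1)] Lam_record[OF rec(2)] by linarith
  have at_2: "?F 2 \<le> int n"
  proof -
    have "\<not> (\<exists>j<1. w j > w 1)" if "w \<in> S_pos" for w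
      using S_pos_nonpos[OF that] S_pos_ge_1[OF that, of 1] by force
    then show ?thesis
      using both_records[of 1] u v FS_ge_1[OF u] by (simp add: N_def)
  qed
  show "\<forall>i \<le> 1 + N. ?F i \<le> int n"
  proof (intro allI impI)
    fix i :: int assume i: "i \<le> 1 + N"
    show "?F i \<le> int n"
    proof (cases "i \<le> 2")
      case True
      then show ?thesis
        using at_2 Lam_nonpos[OF u True] Lam_nonpos[OF v True] by simp
    next
      case False
      then have "2 \<le> i" by simp
      then show ?thesis
        using i
      proof (induction i rule: int_ge_induct)
        case base
        then show ?case using at_2 by simp
      next
        case (step i)
        show ?case
        proof (cases "(\<exists>j<i. u j > u i) \<or> (\<exists>j<i. v j > v i)")
          case True
          \<comment> \<open>The summand i grows by 1, and a nonrecord at i removes at least 1 from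
            the two counts.\<close>
          then have "?F (i + 1) \<le> ?F i"
            using Lam_split[OF u, of i] Lam_split[OF v, of i] by auto
          then show ?thesis using step by linarith
        next
          case False
          then show ?thesis using both_records[of i] step by auto
        qed
      qed
    qed
  qed
qed

theorem theorem1p6:
  fixes u v :: "int \<Rightarrow> int"
  assumes "u \<in> S_pos" and "v \<in> S_pos"
  shows "is_max (int (FS_prod u v))
    {int (Lam i u) + int (Lam i v) + i - 1 | i :: int. i \<le> 1 + int (max (FS u) (FS v))}"
proof -
  let ?F = "\<lambda>i. int (Lam i u) + int (Lam i v) + i - 1" and ?N = "int (max (FS u) (FS v))"
  \<comment> \<open>Both sides have the same upper bounds n \<ge> 1, which determines the
    maximum.\<close>
  have le_iff: "FS_prod u v \<le> n \<longleftrightarrow> (\<forall>i \<le> 1 + ?N. ?F i \<le> int n)" if "n \<ge> 1" for n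
    using FS_prod_le_iff(2)[OF assms that] staircase_product_iff[OF assms] Lam_sum_le_iff[OF assms that]
    by simp
  have N: "?N \<ge> 1"
    using FS_ge_1[OF assms(1)] by simp
  have N_le: "?N \<le> ?F (1 + ?N)"
    by simp
  have upper: "?F i \<le> int (FS_prod u v)" if "i \<le> 1 + ?N" for i
    using le_iff[OF FS_prod_le_iff(1)[OF assms]] that by blast
  have "\<exists>i \<le> 1 + ?N. ?F i = int (FS_prod u v)"
  proof (rule ccontr)
    assume "\<not> ?thesis"
    then have less: "?F i < int (FS_prod u v)" if "i \<le> 1 + ?N" for i
      using upper[OF that] that by force
    \<comment> \<open>\<open>le_iff\<close> needs a positive bound; the value at i = 1 + N is at
      least N \<ge> 1 and lies strictly below \<open>FS_prod u v\<close>.\<close>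
    have "FS_prod u v - 1 \<ge> 1"
      using less[of "1 + ?N"] N N_le by linarith
    moreover have "\<forall>i \<le> 1 + ?N. ?F i \<le> int (FS_prod u v - 1)"
      using less by fastforce
    ultimately have "FS_prod u v \<le> FS_prod u v - 1"
      using le_iff by blast
    then show False
      using FS_prod_le_iff(1)[OF assms] by linarith
  qed
  then obtain i where "i \<le> 1 + ?N" "?F i = int (FS_prod u v)" by blast
  then have "int (FS_prod u v) \<in> {?F i | i. i \<le> 1 + ?N}"
    unfolding mem_Collect_eq by metis
  then show ?thesis
    unfolding is_max_def using upper by blast
qed

end
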